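(* Let $T$ be a p-string. Using $\mathsf{PDAWG}(T)$ enhanced with its suffix links, one can find all substrings of $T$ that p-match a given pattern p-string $P$ in $O(m\log(|\Sigma|+|\Pi|)+\mathit{pocc})$ time, where $m=|P|$ and $\mathit{pocc}$ is the number of occurrences to report.
   Context: $\Sigma$ (static symbols) and $\Pi$ (parameter symbols) are disjoint alphabets; p-strings are strings over $\Sigma\cup\Pi$. Two p-strings $S_1,S_2$ of equal length p-match if there is a bijection $f$ on $\Sigma\cup\Pi$ with $f(a)=a$ for all $a\in\Sigma$ and $f(S_1[i])=S_2[i]$ for all $i$. $\mathcal{N}$ denotes the non-negative integers. The prev-encoding $\mathsf{prev}(S)$ of a p-string $S$ is the string over $\Sigma\cup\mathcal{N}$ with $\mathsf{prev}(S)[i]=S[i]$ if $S[i]\in\Sigma$; $=0$ if $S[i]\in\Pi$ does not occur in $S[1:i-1]$; $=i-j$ if $j<i$ is the last earlier position with $S[j]=S[i]\in\Pi$. Let $\mathsf{Z}(a,j)=0$ if $a\in\mathcal{N}$ and $a>j$, else $\mathsf{Z}(a,j)=a$; the re-encoding of a factor $x$ of a pv-string (a string of the form $\mathsf{prev}(S)$) is $\langle x\rangle[i]=\mathsf{Z}(x[i],i-1)$. For $w=\mathsf{prev}(T)$: $\mathsf{PFactor}(w)=\{\langle x\rangle: x$ a factor of $w\}$; $\mathsf{RPos}_w(x)=\{i\in\{0,\dots,|w|\}: x=\langle w[i-|x|+1:i]\rangle\}$ (with $w[i:j]=\varepsilon$ for $i>j$); $[x]^R_w$ is the class of $x$ under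 $x\equiv y \iff \mathsf{RPos}_w(x)=\mathsf{RPos}_w(y)$; $\max[x]^R_w$, $\min[x]^R_w$ are its longest and shortest elements. $\mathsf{PDAWG}(T)=(V_w,E_w)$ with $V_w=\{[x]^R_w: x\in\mathsf{PFactor}(w)\}$, $E_w=\{([x]^R_w,c,[y]^R_w): y=\max[x]^R_w\cdot c\}$, and suffix links $\mathsf{SL}_w([x]^R_w)=[\langle y[2:|y|]\rangle]^R_w$ where $y=\min[x]^R_w$, defined on all nodes except the source $[\varepsilon]^R_w$. Model of computation: finding the out-going edge of a node with a given label takes $O(\log(|\Sigma|+|\Pi|))$ time (e.g. balanced search trees). *)

theory Defs
  imports Complex_Main "HOL-Library.Sublist"
begin

section \<open>Parameterized strings\<close>

text \<open>Strings are lists, so positions are counted from 0 here; a 1-based position \<open>i\<close> of the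
  usual presentation is the index \<open>i - 1\<close>.\<close>

definition pmatch :: "'a set \<Rightarrow> 'a set \<Rightarrow> 'a list \<Rightarrow> 'a list \<Rightarrow> bool" where
  "pmatch \<Sigma> \<Pi> S1 S2 \<longleftrightarrow> length S1 = length S2 \<and>
     (\<exists>f. bij_betw f (\<Sigma> \<union> \<Pi>) (\<Sigma> \<union> \<Pi>) \<and> (\<forall>a\<in>\<Sigma>. f a = a) \<and>
          (\<forall>i<length S1. f (S1 ! i) = S2 ! i))"

definition occs :: "'a set \<Rightarrow> 'a set \<Rightarrow> 'a list \<Rightarrow> 'a list \<Rightarrow> nat set" where
  "occs \<Sigma> \<Pi> T P = {i. i + length P \<le> length T \<and> pmatch \<Sigma> \<Pi> (take (length P) (drop i T)) P}"

text \<open>The disjoint union of the static symbols and the non-negative integers.\<close>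

datatype 'a pvsym = Stat 'a | Num nat

definition prev :: "'a set \<Rightarrow> 'a list \<Rightarrow> 'a pvsym list" where
  "prev \<Sigma> S = map (\<lambda>i. if S ! i \<in> \<Sigma> then Stat (S ! i)
                      else if S ! i \<notin> set (take i S) then Num 0
                      else Num (i - Max {j. j < i \<and> S ! j = S ! i}))
                 [0..<length S]"

fun Z :: "'a pvsym \<Rightarrow> nat \<Rightarrow> 'a pvsym" where
  "Z (Stat a) j = Stat a"
| "Z (Num n) j = (if n > j then Num 0 else Num n)"

definition reenc :: "'a pvsym list \<Rightarrow> 'a pvsym list" where
  "reenc x = map (\<lambda>i. Z (x ! i) i) [0..<length x]"


section \<open>The parameterized DAWG and its suffix links\<close>

type_synonym 'a node = "'a pvsym list set"

definition PFactor :: "'a pvsym list \<Rightarrow> 'a pvsym list set" where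
  "PFactor w = {reenc x | x. sublist x w}"

text \<open>The elements of \<open>RPos w x\<close> are the numbers of symbols of \<open>w\<close> up to the end of the
  occurrence; they range over \<open>0, \<dots>, |w|\<close>.\<close>

definition RPos :: "'a pvsym list \<Rightarrow> 'a pvsym list \<Rightarrow> nat set" where
  "RPos w x = {i. length x \<le> i \<and> i \<le> length w \<and>
                  x = reenc (take (length x) (drop (i - length x) w))}"

definition rclass :: "'a pvsym list \<Rightarrow> 'a pvsym list \<Rightarrow> 'a node" where
  "rclass w x = {y. RPos w y = RPos w x}"

definition longest :: "'a node \<Rightarrow> 'a pvsym list" where
  "longest U = (ARG_MAX length y. y \<in> U)"

definition shortest :: "'a node \<Rightarrow> 'a pvsym list" where
  "shortest U = (ARG_MIN length y. y \<in> U)"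

definition nodes :: "'a pvsym list \<Rightarrow> 'a node set" where
  "nodes w = rclass w ` PFactor w"

definition edges :: "'a pvsym list \<Rightarrow> ('a node \<times> 'a pvsym \<times> 'a node) set" where
  "edges w = {(rclass w x, c, rclass w y) | x c y.
                x \<in> PFactor w \<and> y \<in> PFactor w \<and> y = longest (rclass w x) @ [c]}"

definition source :: "'a pvsym list \<Rightarrow> 'a node" where
  "source w = rclass w []"

definition SL :: "'a pvsym list \<Rightarrow> 'a node \<Rightarrow> 'a node" where
  "SL w U = rclass w (reenc (tl (shortest U)))"


section \<open>The model of computation\<close>

text \<open>
  A random access machine whose cells hold natural numbers, symbols of the alphabets, or pointers
  to nodes of the automaton. Symbols and pointers are opaque: they can be copied, compared for
  equality, and used in the operations below. The text itself is not accessible; a program only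
  sees the pattern and the automaton.

  The automaton is stored as a linked structure. The out-going edges of a node are kept in an
  ordered dictionary (for instance a balanced search tree), which supports the search for a given
  label and the search for the least integer label that is at least a given number. The suffix
  links can be followed in both directions, the incoming links of a node being kept in an array,
  and the node that represents the prefix of length \<open>i\<close> of the encoded text carries the number \<open>i\<close>.
\<close>

datatype 'a val = Null | Nat nat | Sym 'a | Node "'a node"

type_synonym reg = nat

datatype instr =
    Const reg nat
  | Move reg reg
  | Add reg reg reg
  | Sub reg reg reg
  | Load reg reg
  | Store reg reg
  | TabGet reg reg
  | TabPut reg reg
  | PatLen reg
  | PatSym reg reg
  | Source reg
  | FindEdge reg reg reg
  | NextLabel reg reg reg
  | SufLink reg reg
  | InLink reg reg reg
  | EndPos reg reg
  | Report reg

datatype test = Eq reg reg | Less reg reg | IsNull reg | IsStatic reg | Not test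

datatype com = Skip | Do instr | Seq com com | If test com com | While test com

record 'a env =
  statics :: "'a set"
  encoded :: "'a pvsym list"
  inlinks :: "'a node \<Rightarrow> 'a node list"
  pattern :: "'a list"
  search_cost :: nat

text \<open>Besides registers and memory there is one search tree keyed by symbols, \<open>tab\<close>.\<close>

record 'a state =
  regs :: "reg \<Rightarrow> 'a val"
  mem :: "nat \<Rightarrow> 'a val"
  tab :: "'a \<Rightarrow> 'a val"
  out :: "nat list"

definition init :: "'a state" where
  "init = \<lparr>regs = (\<lambda>_. Null), mem = (\<lambda>_. Null), tab = (\<lambda>_. Null), out = []\<rparr>"

definition lists_inlinks :: "'a pvsym list \<Rightarrow> ('a node \<Rightarrow> 'a node list) \<Rightarrow> bool" where
  "lists_inlinks w ls \<longleftrightarrow> (\<forall>U\<in>nodes w. distinct (ls U) \<and>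
     set (ls U) = {V \<in> nodes w. V \<noteq> source w \<and> SL w V = U})"

fun arith :: "(nat \<Rightarrow> nat \<Rightarrow> nat) \<Rightarrow> 'a val \<Rightarrow> 'a val \<Rightarrow> 'a val" where
  "arith f (Nat m) (Nat n) = Nat (f m n)"
| "arith f _ _ = Null"

definition target :: "'a pvsym list \<Rightarrow> 'a node \<Rightarrow> 'a pvsym \<Rightarrow> 'a val" where
  "target w U c = (if \<exists>V. (U, c, V) \<in> edges w then Node (THE V. (U, c, V) \<in> edges w) else Null)"

fun find_edge :: "'a pvsym list \<Rightarrow> 'a val \<Rightarrow> 'a val \<Rightarrow> 'a val" where
  "find_edge w (Node U) (Sym a) = target w U (Stat a)"
| "find_edge w (Node U) (Nat n) = target w U (Num n)"
| "find_edge w _ _ = Null"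

fun next_label :: "'a pvsym list \<Rightarrow> 'a val \<Rightarrow> 'a val \<Rightarrow> 'a val" where
  "next_label w (Node U) (Nat k) =
     (if \<exists>n\<ge>k. \<exists>V. (U, Num n, V) \<in> edges w
      then Nat (LEAST n. n \<ge> k \<and> (\<exists>V. (U, Num n, V) \<in> edges w)) else Null)"
| "next_label w _ _ = Null"

fun suf_link :: "'a pvsym list \<Rightarrow> 'a val \<Rightarrow> 'a val" where
  "suf_link w (Node U) = (if U = source w then Null else Node (SL w U))"
| "suf_link w _ = Null"

fun in_link :: "('a node \<Rightarrow> 'a node list) \<Rightarrow> 'a val \<Rightarrow> 'a val \<Rightarrow> 'a val" where
  "in_link ls (Node U) (Nat i) = (if i < length (ls U) then Node (ls U ! i) else Null)"
| "in_link ls _ _ = Null"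

fun end_pos :: "'a pvsym list \<Rightarrow> 'a val \<Rightarrow> 'a val" where
  "end_pos w (Node U) =
     (if \<exists>i\<le>length w. U = rclass w (take i w)
      then Nat (THE i. i \<le> length w \<and> U = rclass w (take i w)) else Null)"
| "end_pos w _ = Null"

fun pat_sym :: "'a list \<Rightarrow> 'a val \<Rightarrow> 'a val" where
  "pat_sym P (Nat i) = (if i < length P then Sym (P ! i) else Null)"
| "pat_sym P _ = Null"

abbreviation set_reg :: "'a state \<Rightarrow> reg \<Rightarrow> 'a val \<Rightarrow> 'a state" where
  "set_reg s r v \<equiv> s\<lparr>regs := (regs s)(r := v)\<rparr>"

text \<open>Operations applied to operands of the wrong kind yield \<open>Null\<close> or leave the state unchanged.\<close>

fun step :: "'a env \<Rightarrow> instr \<Rightarrow> 'a state \<Rightarrow> 'a state" where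
  "step e (Const r n) s = set_reg s r (Nat n)"
| "step e (Move r a) s = set_reg s r (regs s a)"
| "step e (Add r a b) s = set_reg s r (arith (+) (regs s a) (regs s b))"
| "step e (Sub r a b) s = set_reg s r (arith (-) (regs s a) (regs s b))"
| "step e (Load r a) s = set_reg s r (case regs s a of Nat i \<Rightarrow> mem s i | _ \<Rightarrow> Null)"
| "step e (Store a b) s =
     (case regs s a of Nat i \<Rightarrow> s\<lparr>mem := (mem s)(i := regs s b)\<rparr> | _ \<Rightarrow> s)"
| "step e (TabGet r a) s = set_reg s r (case regs s a of Sym x \<Rightarrow> tab s x | _ \<Rightarrow> Null)"
| "step e (TabPut a b) s =
     (case regs s a of Sym x \<Rightarrow> s\<lparr>tab := (tab s)(x := regs s b)\<rparr> | _ \<Rightarrow> s)"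
| "step e (PatLen r) s = set_reg s r (Nat (length (pattern e)))"
| "step e (PatSym r a) s = set_reg s r (pat_sym (pattern e) (regs s a))"
| "step e (Source r) s = set_reg s r (Node (source (encoded e)))"
| "step e (FindEdge r a b) s = set_reg s r (find_edge (encoded e) (regs s a) (regs s b))"
| "step e (NextLabel r a b) s = set_reg s r (next_label (encoded e) (regs s a) (regs s b))"
| "step e (SufLink r a) s = set_reg s r (suf_link (encoded e) (regs s a))"
| "step e (InLink r a b) s = set_reg s r (in_link (inlinks e) (regs s a) (regs s b))"
| "step e (EndPos r a) s = set_reg s r (end_pos (encoded e) (regs s a))"
| "step e (Report a) s = (case regs s a of Nat i \<Rightarrow> s\<lparr>out := out s @ [i]\<rparr> | _ \<Rightarrow> s)"

fun cost :: "'a env \<Rightarrow> instr \<Rightarrow> nat" where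
  "cost e (FindEdge _ _ _) = 1 + search_cost e"
| "cost e (NextLabel _ _ _) = 1 + search_cost e"
| "cost e (TabGet _ _) = 1 + search_cost e"
| "cost e (TabPut _ _) = 1 + search_cost e"
| "cost e _ = 1"

fun holds :: "'a env \<Rightarrow> test \<Rightarrow> 'a state \<Rightarrow> bool" where
  "holds e (Eq a b) s \<longleftrightarrow> regs s a = regs s b"
| "holds e (Less a b) s \<longleftrightarrow> (\<exists>m n. regs s a = Nat m \<and> regs s b = Nat n \<and> m < n)"
| "holds e (IsNull a) s \<longleftrightarrow> regs s a = Null"
| "holds e (IsStatic a) s \<longleftrightarrow> (\<exists>x\<in>statics e. regs s a = Sym x)"
| "holds e (Not b) s \<longleftrightarrow> \<not> holds e b s"

text \<open>\<open>exec e c s t s'\<close>: started in \<open>s\<close>, the program \<open>c\<close> terminates in \<open>s'\<close> after time \<open>t\<close>.\<close>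

inductive exec :: "'a env \<Rightarrow> com \<Rightarrow> 'a state \<Rightarrow> nat \<Rightarrow> 'a state \<Rightarrow> bool" for e where
  Skip: "exec e Skip s 1 s"
| Do: "exec e (Do i) s (cost e i) (step e i s)"
| Seq: "exec e c1 s t1 s1 \<Longrightarrow> exec e c2 s1 t2 s2 \<Longrightarrow> exec e (Seq c1 c2) s (t1 + t2) s2"
| IfTrue: "holds e b s \<Longrightarrow> exec e c1 s t s' \<Longrightarrow> exec e (If b c1 c2) s (1 + t) s'"
| IfFalse: "\<not> holds e b s \<Longrightarrow> exec e c2 s t s' \<Longrightarrow> exec e (If b c1 c2) s (1 + t) s'"
| WhileFalse: "\<not> holds e b s \<Longrightarrow> exec e (While b c) s 1 s"
| WhileTrue: "holds e b s \<Longrightarrow> exec e c s t1 s1 \<Longrightarrow> exec e (While b c) s1 t2 s2 \<Longrightarrow>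
    exec e (While b c) s (1 + t1 + t2) s2"

inductive_cases SkipE: "exec e Skip s t s'"
inductive_cases DoE: "exec e (Do i) s t s'"
inductive_cases SeqE: "exec e (Seq c1 c2) s t s'"
inductive_cases IfE: "exec e (If b c1 c2) s t s'"
inductive_cases WhileE: "exec e (While b c) s t s'"

lemma exec_deterministic:
  "exec e c s t s' \<Longrightarrow> exec e c s u s'' \<Longrightarrow> t = u \<and> s' = s''"
proof (induction arbitrary: u s'' rule: exec.induct)
  case (Skip s)
  then show ?case by (auto elim: SkipE)
next
  case (Do i s)
  then show ?case by (auto elim: DoE)
next
  case (Seq c1 s t1 s1 c2 t2 s2)
  from Seq.prems obtain v1 r1 v2 where
    "exec e c1 s v1 r1" "exec e c2 r1 v2 s''" "u = v1 + v2"
    by (rule SeqE)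
  with Seq.IH(1)[of v1 r1] Seq.IH(2)[of v2 s''] show ?case by simp
next
  case (IfTrue b s c1 t s' c2)
  from IfTrue.prems IfTrue.hyps(1) obtain v where "exec e c1 s v s''" "u = 1 + v"
    by (cases rule: IfE) auto
  with IfTrue.IH[of v s''] show ?case by simp
next
  case (IfFalse b s c2 t s' c1)
  from IfFalse.prems IfFalse.hyps(1) obtain v where "exec e c2 s v s''" "u = 1 + v"
    by (cases rule: IfE) auto
  with IfFalse.IH[of v s''] show ?case by simp
next
  case (WhileFalse b s c)
  then show ?case by (auto elim: WhileE)
next
  case (WhileTrue b s c t1 s1 t2 s2)
  from WhileTrue.prems WhileTrue.hyps(1) obtain v1 r1 v2 where
    "exec e c s v1 r1" "exec e (While b c) r1 v2 s''" "u = 1 + v1 + v2"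
    by (cases rule: WhileE) auto
  with WhileTrue.IH(1)[of v1 r1] WhileTrue.IH(2)[of v2 s''] show ?case by simp
qed

text \<open>For alphabets with at least two symbols this is \<open>log\<^sub>2 (|\<Sigma>| + |\<Pi>|)\<close>; the maximum only keeps
  the bounds meaningful in the degenerate cases, where that logarithm is not positive.\<close>

definition log_size :: "'a set \<Rightarrow> 'a set \<Rightarrow> real" where
  "log_size \<Sigma> \<Pi> = max 1 (log 2 (real (card \<Sigma> + card \<Pi>)))"

end

theory Submission
  imports Defs
begin

text \<open>
  Two p-strings match iff their encodings agree, so the occurrences of \<open>P\<close> are read off
  \<open>RPos w (prev P)\<close>, where \<open>w = prev T\<close>. Reading \<open>P\<close> from left to right, the algorithm maintains
  the node of the current prefix of \<open>prev P\<close>. For a static symbol or a repeated parameter, this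
  prefix \<open>x\<close> and the longest element of its class continue in the same way, so one edge search
  suffices. For a new parameter, the out-going edges that matter carry the label \<open>0\<close> or a label
  exceeding \<open>|x|\<close>, and inspecting two of them determines the next node.

  The positions of a node are partitioned by the nodes whose suffix links lead to it, except for
  the length of its longest element if that element is a prefix of \<open>w\<close>. A node that does not
  represent a prefix has at least two incoming links, so the subtree below the node of \<open>prev P\<close> has
  size linear in the number of its positions and can be traversed with a stack.
\<close>

section \<open>Encodings and matching\<close>

lemma length_reenc [simp]: "length (reenc x) = length x"
  by (simp add: reenc_def)

lemma nth_reenc [simp]: "i < length x \<Longrightarrow> reenc x ! i = Z (x ! i) i"
  by (simp add: reenc_def)

lemma Z_Z: "j \<le> k \<Longrightarrow> Z (Z c k) j = Z c j"
  by (cases c) auto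

text \<open>Dropping only lowers the index of each remaining symbol, so a number that the inner pass
  sets to zero exceeds the smaller bound as well (\<open>Z_Z\<close>).\<close>

lemma reenc_drop_reenc: "reenc (drop k (reenc x)) = reenc (drop k x)"
  by (rule nth_equalityI) (auto simp: Z_Z)

lemma reenc_snoc: "reenc (x @ [c]) = reenc x @ [Z c (length x)]"
  by (rule nth_equalityI) (auto simp: nth_append less_Suc_eq)

lemma length_prev [simp]: "length (prev \<Sigma> S) = length S"
  by (simp add: prev_def)

lemma prev_static: "i < length S \<Longrightarrow> S ! i \<in> \<Sigma> \<Longrightarrow> prev \<Sigma> S ! i = Stat (S ! i)"
  by (simp add: prev_def)

lemma prev_first:
  "i < length S \<Longrightarrow> S ! i \<notin> \<Sigma> \<Longrightarrow> (\<And>j. j < i \<Longrightarrow> S ! j \<noteq> S ! i) \<Longrightarrow> prev \<Sigma> S ! i = Num 0"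
  by (auto simp: prev_def in_set_conv_nth)

lemma prev_repeat:
  assumes "i < length S" "S ! i \<notin> \<Sigma>" "p < i" "S ! p = S ! i"
    and last: "\<And>j. p < j \<Longrightarrow> j < i \<Longrightarrow> S ! j \<noteq> S ! i"
  shows "prev \<Sigma> S ! i = Num (i - p)"
proof -
  have "Max {j. j < i \<and> S ! j = S ! i} = p"
  proof (rule Max_eqI)
    fix j assume "j \<in> {j. j < i \<and> S ! j = S ! i}"
    then show "j \<le> p" using last[of j] by (cases "p < j") auto
  qed (use assms in auto)
  moreover have "S ! i \<in> set (take i S)"
    using assms by (force simp: in_set_conv_nth)
  ultimately show ?thesis
    using assms by (simp add: prev_def)
qed

text \<open>Exposes the last earlier occurrence \<open>p\<close> of a repeated parameter, so that
  the arguments below can compare positions instead of handling \<open>Max\<close>.\<close>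

lemma prev_cases:
  assumes "i < length S"
  obtains "S ! i \<in> \<Sigma>" "prev \<Sigma> S ! i = Stat (S ! i)"
  | "S ! i \<notin> \<Sigma>" "\<And>j. j < i \<Longrightarrow> S ! j \<noteq> S ! i" "prev \<Sigma> S ! i = Num 0"
  | p where "S ! i \<notin> \<Sigma>" "p < i" "S ! p = S ! i" "\<And>j. p < j \<Longrightarrow> j < i \<Longrightarrow> S ! j \<noteq> S ! i"
      "prev \<Sigma> S ! i = Num (i - p)"
proof -
  consider "S ! i \<in> \<Sigma>" | "S ! i \<notin> \<Sigma>" "\<And>j. j < i \<Longrightarrow> S ! j \<noteq> S ! i"
    | q where "S ! i \<notin> \<Sigma>" "q < i" "S ! q = S ! i" by blast
  then show ?thesis
  proof cases
    case 1
    then show ?thesis by (intro that(1) prev_static assms)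
  next
    case 2
    then show ?thesis by (intro that(2) prev_first assms) auto
  next
    case (3 q)
    let ?J = "{j. j < i \<and> S ! j = S ! i}"
    have fin: "finite ?J" "?J \<noteq> {}" using 3 by auto
    from Max_in[OF this] have p: "Max ?J < i" "S ! Max ?J = S ! i" by auto
    have last: "S ! j \<noteq> S ! i" if "Max ?J < j" "j < i" for j
    proof
      assume "S ! j = S ! i"
      with that have "j \<le> Max ?J" using fin(1) by (intro Max_ge) auto
      with that show False by simp
    qed
    show ?thesis
      by (rule that(3)[OF 3(1) p last prev_repeat[OF assms 3(1) p last]])
  qed
qed

text \<open>A pointer back to \<open>p\<close> survives in a factor starting at \<open>k\<close> iff
  \<open>k \<le> p\<close>. As its value is \<open>k + i - p\<close>, this is exactly the comparison
  with \<open>i\<close> that \<open>reenc\<close> makes.\<close>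

lemma prev_factor:
  "prev \<Sigma> (take l (drop k S)) = reenc (take l (drop k (prev \<Sigma> S)))"
proof (rule nth_equalityI)
  fix i assume "i < length (prev \<Sigma> (take l (drop k S)))"
  then have i: "i < l" "k + i < length S" by auto
  let ?F = "take l (drop k S)"
  have F: "?F ! j = S ! (k + j)" if "j \<le> i" for j using i that by simp
  have len: "i < length ?F" using i by auto
  show "prev \<Sigma> ?F ! i = reenc (take l (drop k (prev \<Sigma> S))) ! i"
    using i(2)
  proof (cases rule: prev_cases[of "k + i" S \<Sigma>])
    case 1
    then show ?thesis using i len F by (simp add: prev_static)
  next
    case 2
    then have "prev \<Sigma> ?F ! i = Num 0" using len F by (intro prev_first) auto
    then show ?thesis using i 2 by simp
  next
    case (3 p)
    show ?thesis
    proof (cases "p < k")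
      case True
      then have "prev \<Sigma> ?F ! i = Num 0" using 3 len F by (intro prev_first) auto
      then show ?thesis using i 3 True by simp
    next
      case False
      then have "prev \<Sigma> ?F ! i = Num (i - (p - k))"
        using 3 len by (intro prev_repeat) (auto simp: F)
      moreover have "i - (p - k) = k + i - p" using False by simp
      ultimately show ?thesis using i 3 False by simp
    qed
  qed
qed auto

lemma reenc_prev: "reenc (prev \<Sigma> S) = prev \<Sigma> S"
  using prev_factor[of \<Sigma> "length S" 0 S] by simp

lemma prev_take: "prev \<Sigma> (take n S) = take n (prev \<Sigma> S)"
proof (rule nth_equalityI)
  fix i assume "i < length (prev \<Sigma> (take n S))"
  then show "prev \<Sigma> (take n S) ! i = take n (prev \<Sigma> S) ! i"
    using prev_factor[of \<Sigma> n 0 S] arg_cong[OF reenc_prev, of "\<lambda>x. x ! i" \<Sigma> S] by simp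
qed auto

section \<open>Matching as equality of encodings\<close>

lemma pmatch_imp_prev_eq:
  assumes "pmatch \<Sigma> \<Pi> S1 S2" "S1 \<in> lists (\<Sigma> \<union> \<Pi>)"
  shows "prev \<Sigma> S1 = prev \<Sigma> S2"
proof -
  from assms obtain f where len: "length S1 = length S2" and bij: "bij_betw f (\<Sigma> \<union> \<Pi>) (\<Sigma> \<union> \<Pi>)"
    and fix\<Sigma>: "\<forall>a\<in>\<Sigma>. f a = a" and f: "\<forall>i<length S1. f (S1 ! i) = S2 ! i"
    by (auto simp: pmatch_def)
  have mem: "S1 ! i \<in> \<Sigma> \<union> \<Pi>" if "i < length S1" for i
    using assms(2) that by (auto dest: nth_mem)
  have inj: "inj_on f (\<Sigma> \<union> \<Pi>)" using bij by (rule bij_betw_imp_inj_on)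
  \<comment> \<open>An encoding is determined by the static symbols and by which positions carry
    equal symbols; \<open>f\<close> preserves both.\<close>
  have eq: "S2 ! i = S2 ! j \<longleftrightarrow> S1 ! i = S1 ! j" if "i < length S1" "j < length S1" for i j
    using inj_on_eq_iff[OF inj mem mem, OF that] f that by simp
  \<comment> \<open>If \<open>S2 ! i\<close> is static, then \<open>f\<close> maps it and
    \<open>S1 ! i\<close> to the same symbol, so injectivity identifies them.\<close>
  have stat: "S2 ! i \<in> \<Sigma> \<longleftrightarrow> S1 ! i \<in> \<Sigma>" if "i < length S1" for i
    using fix\<Sigma> f that mem[OF that] inj_on_eq_iff[OF inj mem[OF that], of "S2 ! i"] by auto
  show ?thesis
  proof (rule nth_equalityI)
    fix i assume "i < length (prev \<Sigma> S1)"
    then have i: "i < length S1" "i < length S2" using len by auto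
    show "prev \<Sigma> S1 ! i = prev \<Sigma> S2 ! i"
      using i(1)
    proof (cases rule: prev_cases[of i S1 \<Sigma>])
      case 1
      then show ?thesis using i f fix\<Sigma> stat by (metis prev_static)
    next
      case 2
      then have "prev \<Sigma> S2 ! i = Num 0" using i stat eq by (intro prev_first) auto
      then show ?thesis using 2 by simp
    next
      case (3 p)
      then have "prev \<Sigma> S2 ! i = Num (i - p)" using i stat eq by (intro prev_repeat) auto
      then show ?thesis using 3 by simp
    qed
  qed (simp add: len)
qed

lemma prev_eq_static:
  assumes "prev \<Sigma> S1 = prev \<Sigma> S2" "i < length S1"
  shows "S1 ! i \<in> \<Sigma> \<longleftrightarrow> S2 ! i \<in> \<Sigma>" and "S1 ! i \<in> \<Sigma> \<Longrightarrow> S2 ! i = S1 ! i"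
proof -
  have "length S1 = length S2" using assms(1) by (metis length_prev)
  then have i: "i < length S1" "i < length S2" using assms by auto
  have e: "prev \<Sigma> S1 ! i = prev \<Sigma> S2 ! i" using assms(1) by simp
  have "(S1 ! i \<in> \<Sigma> \<longleftrightarrow> S2 ! i \<in> \<Sigma>) \<and> (S1 ! i \<in> \<Sigma> \<longrightarrow> S2 ! i = S1 ! i)"
    using e i by (auto simp: prev_def split: if_splits)
  then show "S1 ! i \<in> \<Sigma> \<longleftrightarrow> S2 ! i \<in> \<Sigma>" and "S1 ! i \<in> \<Sigma> \<Longrightarrow> S2 ! i = S1 ! i" by auto
qed

text \<open>By induction on the length of a prefix: a parameter at its end is either new, hence
  differs from all earlier symbols, or equals the symbol at the \<open>p\<close> that the encoding
  reveals, and comparisons with \<open>p\<close> are already settled.\<close>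

lemma prev_eq_same_pattern:
  assumes "prev \<Sigma> S1 = prev \<Sigma> S2" "i < length S1" "j < length S1"
  shows "S1 ! i = S1 ! j \<longleftrightarrow> S2 ! i = S2 ! j"
proof -
  have len: "length S1 = length S2" using assms(1) by (metis length_prev)
  have "\<forall>i<n. \<forall>j<n. S1 ! i = S1 ! j \<longleftrightarrow> S2 ! i = S2 ! j" if "n \<le> length S1" for n
    using that
  proof (induction n)
    case (Suc n)
    then have n: "n < length S1" "n < length S2" using len by auto
    have IH: "S1 ! i = S1 ! j \<longleftrightarrow> S2 ! i = S2 ! j" if "i < n" "j < n" for i j
      using Suc that by auto
    have e: "prev \<Sigma> S1 ! n = prev \<Sigma> S2 ! n" using assms(1) by simp
    have new: "S1 ! n = S1 ! j \<longleftrightarrow> S2 ! n = S2 ! j" if j: "j < n" for j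
      using n(1)
    proof (cases rule: prev_cases[of n S1 \<Sigma>])
      case 1
      then show ?thesis
        using prev_eq_static[OF assms(1), of j] prev_eq_static[OF assms(1), of n] j n by auto
    next
      case 2
      with e have "prev \<Sigma> S2 ! n = Num 0" by simp
      with n(2) have "\<forall>j<n. S2 ! j \<noteq> S2 ! n"
        by (cases rule: prev_cases[of n S2 \<Sigma>]) auto
      then show ?thesis using 2 j by metis
    next
      case (3 p)
      with e have e2: "prev \<Sigma> S2 ! n = Num (n - p)" by simp
      have "S2 ! p = S2 ! n"
        using n(2)
      proof (cases rule: prev_cases[of n S2 \<Sigma>])
        case (3 q)
        then have "q = p" using e2 \<open>p < n\<close> by auto
        then show ?thesis using 3 by simp
      qed (use e2 \<open>p < n\<close> in auto)
      then show ?thesis using 3 IH[of p j] j by simp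
    qed
    show ?case
    proof (intro allI impI)
      fix i j assume "i < Suc n" "j < Suc n"
      then consider "i < n" "j < n" | "i = n" "j < n" | "i < n" "j = n" | "i = n" "j = n"
        by linarith
      then show "S1 ! i = S1 ! j \<longleftrightarrow> S2 ! i = S2 ! j"
      proof cases
        case 1 then show ?thesis by (rule IH)
      next
        case 2 then show ?thesis using new by simp
      next
        case 3 then show ?thesis using new[of i] by auto
      next
        case 4 then show ?thesis by simp
      qed
    qed
  qed simp
  from this[of "length S1"] assms show ?thesis by blast
qed

text \<open>Complements of equally large subsets of a finite set are equally large, so a bijection
  between them completes \<open>g\<close>. This matters because p-matching asks for a permutation of
  the whole alphabet.\<close>

lemma bij_betw_extend:
  assumes "finite B" "bij_betw g A A'" "A \<subseteq> B" "A' \<subseteq> B"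
  obtains h where "bij_betw h B B" "\<And>a. a \<in> A \<Longrightarrow> h a = g a"
proof -
  have fin: "finite A" "finite A'" using assms finite_subset by auto
  have "card (B - A) = card (B - A')"
    using assms bij_betw_same_card[OF assms(2)] fin by (simp add: card_Diff_subset)
  then obtain k where k: "bij_betw k (B - A) (B - A')"
    using assms(1) by (metis finite_Diff finite_same_card_bij)
  let ?h = "\<lambda>a. if a \<in> A then g a else k a"
  have "bij_betw ?h A A'" using assms(2) by (simp cong: bij_betw_cong)
  moreover have "bij_betw ?h (B - A) (B - A')"
    using k by (subst bij_betw_cong[of _ _ k]) auto
  ultimately have "bij_betw ?h (A \<union> (B - A)) (A' \<union> (B - A'))"
    by (rule bij_betw_combine) auto
  moreover have "A \<union> (B - A) = B" "A' \<union> (B - A') = B" using assms by auto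
  ultimately show ?thesis using that[of ?h] by auto
qed

lemma prev_eq_imp_pmatch:
  assumes "prev \<Sigma> S1 = prev \<Sigma> S2" "finite \<Sigma>" "finite \<Pi>"
    and S: "S1 \<in> lists (\<Sigma> \<union> \<Pi>)" "S2 \<in> lists (\<Sigma> \<union> \<Pi>)"
  shows "pmatch \<Sigma> \<Pi> S1 S2"
proof -
  have len: "length S1 = length S2" using assms(1) by (metis length_prev)
  \<comment> \<open>The image of a parameter is read off at an arbitrary position where
    \<open>S1\<close> has it; \<open>prev_eq_same_pattern\<close> makes the choice
    immaterial.\<close>
  define g where "g a = (if a \<in> \<Sigma> then a else S2 ! (SOME i. i < length S1 \<and> S1 ! i = a))" for a
  have g: "g (S1 ! i) = S2 ! i" if "i < length S1" for i
  proof (cases "S1 ! i \<in> \<Sigma>")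
    case True
    then show ?thesis using prev_eq_static[OF assms(1) that] by (simp add: g_def)
  next
    case False
    let ?j = "SOME j. j < length S1 \<and> S1 ! j = S1 ! i"
    have "?j < length S1 \<and> S1 ! ?j = S1 ! i"
      by (rule someI) (use that in auto)
    then show ?thesis
      using prev_eq_same_pattern[OF assms(1), of ?j i] that False by (simp add: g_def)
  qed
  \<comment> \<open>All static symbols enter the domain, even those absent from the strings, so that
    the extended bijection still fixes them.\<close>
  let ?A = "\<Sigma> \<union> set S1" and ?A' = "\<Sigma> \<union> set S2"
  have inj: "inj_on g ?A"
  proof (rule inj_onI)
    fix a b assume a: "a \<in> ?A" and b: "b \<in> ?A" and eq: "g a = g b"
    have S1_stat: "S1 ! i = c" if "i < length S1" "c \<in> \<Sigma>" "S2 ! i = c" for i c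
      using prev_eq_static[OF assms(1) that(1)] that by simp
    have g_stat: "g c = c" if "c \<in> \<Sigma>" for c using that by (simp add: g_def)
    consider "a \<in> \<Sigma>" "b \<in> \<Sigma>" | i where "a \<in> \<Sigma>" "i < length S1" "b = S1 ! i"
      | i where "b \<in> \<Sigma>" "i < length S1" "a = S1 ! i"
      | i j where "i < length S1" "a = S1 ! i" "j < length S1" "b = S1 ! j"
      using a b by (auto simp: in_set_conv_nth)
    then show "a = b"
    proof cases
      case 1
      then show ?thesis using eq g_stat by simp
    next
      case (2 i)
      then have "S2 ! i = a" using eq g_stat[of a] g[of i] by simp
      from S1_stat[OF 2(2,1) this] show ?thesis using 2 by simp
    next
      case (3 i)
      then have "S2 ! i = b" using eq g_stat[of b] g[of i] by simp
      from S1_stat[OF 3(2,1) this] show ?thesis using 3 by simp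
    next
      case (4 i j)
      then show ?thesis using eq g[of i] g[of j] prev_eq_same_pattern[OF assms(1), of i j] by simp
    qed
  qed
  have "g ` ?A = ?A'"
  proof -
    have "g ` set S1 = set S2"
      using g len by (force simp: set_conv_nth)
    moreover have "g ` \<Sigma> = \<Sigma>" by (auto simp: g_def)
    ultimately show ?thesis by (simp add: image_Un)
  qed
  with inj have "bij_betw g ?A ?A'" by (simp add: bij_betw_def)
  moreover have "finite (\<Sigma> \<union> \<Pi>)" "?A \<subseteq> \<Sigma> \<union> \<Pi>" "?A' \<subseteq> \<Sigma> \<union> \<Pi>" using assms by auto
  ultimately obtain h where "bij_betw h (\<Sigma> \<union> \<Pi>) (\<Sigma> \<union> \<Pi>)" "\<And>a. a \<in> ?A \<Longrightarrow> h a = g a"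
    by (metis bij_betw_extend)
  then show ?thesis
    unfolding pmatch_def using len g by (intro conjI exI[of _ h]) (auto simp: g_def)
qed

lemma pmatch_iff_prev_eq:
  assumes "finite \<Sigma>" "finite \<Pi>" "S1 \<in> lists (\<Sigma> \<union> \<Pi>)" "S2 \<in> lists (\<Sigma> \<union> \<Pi>)"
  shows "pmatch \<Sigma> \<Pi> S1 S2 \<longleftrightarrow> prev \<Sigma> S1 = prev \<Sigma> S2"
  using assms pmatch_imp_prev_eq prev_eq_imp_pmatch by metis

text \<open>By \<open>prev_factor\<close>, an occurrence is a factor whose re-encoding is
  \<open>prev \<Sigma> P\<close>. \<open>occs\<close> records its start and \<open>RPos\<close> its
  end, whence the shift by \<open>length P\<close>.\<close>

lemma occs_eq_RPos:
  assumes "finite \<Sigma>" "finite \<Pi>" "T \<in> lists (\<Sigma> \<union> \<Pi>)" "P \<in> lists (\<Sigma> \<union> \<Pi>)"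
  shows "occs \<Sigma> \<Pi> T P = (\<lambda>i. i - length P) ` RPos (prev \<Sigma> T) (prev \<Sigma> P)"
proof -
  have "i \<in> occs \<Sigma> \<Pi> T P \<longleftrightarrow> i + length P \<in> RPos (prev \<Sigma> T) (prev \<Sigma> P)" for i
  proof -
    have "take (length P) (drop i T) \<in> lists (\<Sigma> \<union> \<Pi>)"
      using assms(3) by (auto dest: in_set_takeD in_set_dropD)
    then show ?thesis
      using assms by (auto simp: occs_def RPos_def pmatch_iff_prev_eq prev_factor)
  qed
  moreover have "length P \<le> i" if "i \<in> RPos (prev \<Sigma> T) (prev \<Sigma> P)" for i
    using that by (simp add: RPos_def)
  ultimately show ?thesis by (force simp: image_iff)
qed


section \<open>The automaton and its suffix link tree\<close>

text \<open>Factors are indexed by their end, because the elements of a class share their end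
  positions and differ only in length.\<close>

definition factor_at :: "'a pvsym list \<Rightarrow> nat \<Rightarrow> nat \<Rightarrow> 'a pvsym list" where
  "factor_at w i l = reenc (take l (drop (i - l) w))"

lemma length_factor_at: "l \<le> i \<Longrightarrow> i \<le> length w \<Longrightarrow> length (factor_at w i l) = l"
  by (simp add: factor_at_def)

lemma RPos_iff:
  "i \<in> RPos w x \<longleftrightarrow> length x \<le> i \<and> i \<le> length w \<and> factor_at w i (length x) = x"
  by (auto simp: RPos_def factor_at_def)

lemma finite_RPos [simp]: "finite (RPos w x)"
  by (rule finite_subset[of _ "{..length w}"]) (auto simp: RPos_iff)

lemma reenc_drop_factor_at:
  assumes "l \<le> l'" "l' \<le> i" "i \<le> length w"
  shows "reenc (drop (l' - l) (factor_at w i l')) = factor_at w i l"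
proof -
  have "drop (l' - l) (take l' (drop (i - l') w)) = take l (drop (i - l) w)"
    using assms by (simp add: drop_take add.commute)
  then show ?thesis by (simp add: factor_at_def reenc_drop_reenc)
qed

lemma in_RPos_factor_at: "l \<le> i \<Longrightarrow> i \<le> length w \<Longrightarrow> i \<in> RPos w (factor_at w i l)"
  by (simp add: RPos_iff length_factor_at)

lemma RPos_eq_if_length_eq:
  "i \<in> RPos w x \<Longrightarrow> i \<in> RPos w y \<Longrightarrow> length x = length y \<Longrightarrow> x = y"
  by (metis RPos_iff)

text \<open>A common end position makes \<open>x\<close> the re-encoded suffix of \<open>y\<close>.
  This relation does not mention the position, so it carries over to every position of
  \<open>y\<close>.\<close>

lemma RPos_mono:
  assumes "i \<in> RPos w x" "i \<in> RPos w y" "length x \<le> length y"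
  shows "RPos w y \<subseteq> RPos w x"
proof
  fix j assume j: "j \<in> RPos w y"
  have "factor_at w j (length x) = reenc (drop (length y - length x) y)"
    using reenc_drop_factor_at[OF assms(3), of j w] j by (simp add: RPos_iff)
  also have "\<dots> = x"
    using reenc_drop_factor_at[OF assms(3), of i w] assms by (simp add: RPos_iff)
  finally show "j \<in> RPos w x" using j assms(3) by (simp add: RPos_iff)
qed

lemma RPos_reenc_tl:
  assumes "i \<in> RPos w y" "y \<noteq> []"
  shows "i \<in> RPos w (reenc (tl y))"
proof -
  have "reenc (tl y) = factor_at w i (length y - 1)"
    using reenc_drop_factor_at[of "length y - 1" "length y" i w] assms
    by (cases y) (auto simp: RPos_iff drop_Suc)
  moreover have "i \<in> RPos w (factor_at w i (length y - 1))"
    using assms(1) by (intro in_RPos_factor_at) (auto simp: RPos_iff)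
  ultimately show ?thesis by simp
qed

text \<open>The appended symbol is truncated with bound \<open>length x\<close>. Elements of one
  class differ in length, so the same symbol of \<open>w\<close> may extend them differently; this
  is the difficulty with new parameters.\<close>

lemma RPos_snoc:
  "RPos w (x @ [c]) = {Suc i | i. i \<in> RPos w x \<and> i < length w \<and> Z (w ! i) (length x) = c}"
proof -
  have "Suc i \<in> RPos w (x @ [c]) \<longleftrightarrow> i \<in> RPos w x \<and> i < length w \<and> Z (w ! i) (length x) = c" for i
  proof (cases "length x \<le> i \<and> i < length w")
    case True
    then have "take (Suc (length x)) (drop (i - length x) w)
        = take (length x) (drop (i - length x) w) @ [w ! i]"
      by (subst take_Suc_conv_app_nth) (auto simp: nth_drop)
    moreover have "min (length w - (i - length x)) (length x) = length x" using True by (intro min_absorb2) linarith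
    ultimately have "factor_at w (Suc i) (Suc (length x)) = factor_at w i (length x) @ [Z (w ! i) (length x)]"
      using True by (simp add: factor_at_def reenc_snoc)
    then show ?thesis using True by (auto simp: RPos_iff)
  qed (auto simp: RPos_iff)
  moreover have "0 \<notin> RPos w (x @ [c])" by (simp add: RPos_iff)
  ultimately show ?thesis by (intro set_eqI, rename_tac j, case_tac j) simp_all
qed

lemma RPos_Nil: "RPos w [] = {..length w}"
  by (auto simp: RPos_iff factor_at_def reenc_def)

lemma PFactor_iff: "x \<in> PFactor w \<longleftrightarrow> RPos w x \<noteq> {}"
proof
  assume "x \<in> PFactor w"
  then obtain y u v where "x = reenc y" "w = u @ y @ v" by (auto simp: PFactor_def sublist_def)
  then have "length u + length y \<in> RPos w x" by (simp add: RPos_def)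
  then show "RPos w x \<noteq> {}" by blast
next
  assume "RPos w x \<noteq> {}"
  then obtain i where "i \<in> RPos w x" by blast
  moreover have "sublist (take (length x) (drop (i - length x) w)) w"
    by (meson sublist_drop sublist_order.order_trans sublist_take)
  ultimately show "x \<in> PFactor w"
    unfolding PFactor_def RPos_def by blast
qed

section \<open>Classes and their extremal elements\<close>

lemma rclass_eq_iff: "rclass w x = rclass w y \<longleftrightarrow> RPos w x = RPos w y"
  by (auto simp: rclass_def)

lemma mem_rclass: "y \<in> rclass w x \<longleftrightarrow> RPos w y = RPos w x"
  by (simp add: rclass_def)

text \<open>An element with a position is no longer than \<open>w\<close>, so the maximum
  exists.\<close>

lemma longest_rclass:
  assumes "RPos w x \<noteq> {}"
  shows "RPos w (longest (rclass w x)) = RPos w x"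
    and "RPos w y = RPos w x \<Longrightarrow> length y \<le> length (longest (rclass w x))"
proof -
  have bound: "\<forall>y. y \<in> rclass w x \<longrightarrow> length y < Suc (length w)"
    using assms by (fastforce simp: mem_rclass RPos_iff)
  have "longest (rclass w x) \<in> rclass w x \<and>
      (\<forall>y. y \<in> rclass w x \<longrightarrow> length y \<le> length (longest (rclass w x)))"
    unfolding longest_def by (rule arg_max_nat_lemma[OF _ bound]) (simp add: mem_rclass)
  then show "RPos w (longest (rclass w x)) = RPos w x"
    and "RPos w y = RPos w x \<Longrightarrow> length y \<le> length (longest (rclass w x))"
    by (auto simp: mem_rclass)
qed

lemma shortest_rclass:
  shows "RPos w (shortest (rclass w x)) = RPos w x"
    and "RPos w y = RPos w x \<Longrightarrow> length (shortest (rclass w x)) \<le> length y"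
proof -
  have "shortest (rclass w x) \<in> rclass w x \<and>
      (\<forall>y. y \<in> rclass w x \<longrightarrow> length (shortest (rclass w x)) \<le> length y)"
    unfolding shortest_def by (rule arg_min_nat_lemma) (simp add: mem_rclass)
  then show "RPos w (shortest (rclass w x)) = RPos w x"
    and "RPos w y = RPos w x \<Longrightarrow> length (shortest (rclass w x)) \<le> length y"
    by (auto simp: mem_rclass)
qed

lemma rclass_in_nodes: "RPos w x \<noteq> {} \<Longrightarrow> rclass w x \<in> nodes w"
  by (simp add: nodes_def PFactor_iff)

text \<open>The empty string is the only one ending at position 0, so it is alone in its
  class.\<close>

lemma rclass_source_iff: "rclass w x = source w \<longleftrightarrow> x = []"
proof
  assume "rclass w x = source w"
  then have "0 \<in> RPos w x" by (simp add: source_def rclass_eq_iff RPos_Nil)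
  then show "x = []" by (simp add: RPos_iff)
qed (simp add: source_def)

section \<open>Edges, suffix links and loci\<close>

lemma edges_iff:
  assumes "RPos w x \<noteq> {}"
  shows "(rclass w x, c, V) \<in> edges w \<longleftrightarrow>
    RPos w (longest (rclass w x) @ [c]) \<noteq> {} \<and> V = rclass w (longest (rclass w x) @ [c])"
  using assms unfolding edges_def PFactor_iff by auto

text \<open>Here \<open>y\<close> must be the shortest element of its class: by monotonicity, a
  strictly shorter one would force \<open>reenc (tl y)\<close>, whose length lies between, into the
  class as well.\<close>

lemma SL_rclass:
  assumes "RPos w y \<noteq> {}" "y \<noteq> []" "RPos w (reenc (tl y)) \<noteq> RPos w y"
  shows "SL w (rclass w y) = rclass w (reenc (tl y))"
proof -
  obtain i where i: "i \<in> RPos w y" using assms(1) by blast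
  have it: "i \<in> RPos w (reenc (tl y))" using RPos_reenc_tl[OF i assms(2)] .
  let ?s = "shortest (rclass w y)"
  have s: "RPos w ?s = RPos w y" by (rule shortest_rclass)
  have "length ?s = length y"
  proof (rule ccontr)
    assume "length ?s \<noteq> length y"
    moreover have "length ?s \<le> length y" by (rule shortest_rclass) simp
    ultimately have "length ?s \<le> length (reenc (tl y))" by simp
    then have "RPos w (reenc (tl y)) \<subseteq> RPos w ?s" using i it s by (intro RPos_mono[of i]) auto
    moreover have "RPos w y \<subseteq> RPos w (reenc (tl y))"
      using i it by (intro RPos_mono[of i]) auto
    ultimately show False using s assms(3) by auto
  qed
  then have "?s = y" using i s by (intro RPos_eq_if_length_eq[of i w]) auto
  then show ?thesis by (simp add: SL_def)
qed

text \<open>The content of the register for the current node once \<open>x\<close> has been read; \<open>Null\<close> records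
  that \<open>x\<close> does not occur.\<close>

definition locus :: "'a pvsym list \<Rightarrow> 'a pvsym list \<Rightarrow> 'a val" where
  "locus w x = (if RPos w x = {} then Null else Node (rclass w x))"

lemma locus_eqI: "RPos w x = RPos w y \<Longrightarrow> locus w x = locus w y"
  by (simp add: locus_def rclass_eq_iff)

lemma target_rclass:
  assumes "RPos w x \<noteq> {}"
  shows "target w (rclass w x) c = locus w (longest (rclass w x) @ [c])"
  using assms by (auto simp: target_def edges_iff locus_def)

lemma locus_snoc_Null: "locus w x = Null \<Longrightarrow> locus w (x @ [c]) = Null"
  by (auto simp: locus_def RPos_snoc split: if_splits)

text \<open>By \<open>stable\<close>, \<open>c\<close> arises from the same symbols of
  \<open>w\<close> under every bound from \<open>length x\<close> on. Hence \<open>c\<close> extends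
  \<open>x\<close> and the longest element of its class at the same positions.\<close>

lemma locus_snoc_stable:
  assumes "RPos w x \<noteq> {}" and stable: "\<And>k b. length x \<le> k \<Longrightarrow> Z b k = c \<longleftrightarrow> Z b (length x) = c"
  shows "target w (rclass w x) c = locus w (x @ [c])"
proof -
  have "length x \<le> length (longest (rclass w x))" using longest_rclass(2)[OF assms(1) refl] .
  then have "Z b (length (longest (rclass w x))) = c \<longleftrightarrow> Z b (length x) = c" for b
    by (rule stable)
  then have "RPos w (longest (rclass w x) @ [c]) = RPos w (x @ [c])"
    unfolding RPos_snoc longest_rclass(1)[OF assms(1)] by blast
  then show ?thesis using target_rclass[OF assms(1)] locus_eqI by metis
qed

lemma find_edge_static: "find_edge w (locus w x) (Sym a) = locus w (x @ [Stat a])"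
proof (cases "RPos w x = {}")
  case True
  then show ?thesis using locus_snoc_Null[of w x] by (simp add: locus_def)
next
  case False
  have "Z b k = Stat a \<longleftrightarrow> Z b l = Stat a" for b k l by (cases b) auto
  then have "target w (rclass w x) (Stat a) = locus w (x @ [Stat a])"
    by (intro locus_snoc_stable False) blast
  then show ?thesis using False by (simp add: locus_def[of w x])
qed

text \<open>A positive number that is at most \<open>length x\<close> is neither created nor erased
  by truncation with a bound of at least \<open>length x\<close>. Zero is different, as truncation
  creates it.\<close>

lemma find_edge_repeat:
  assumes "0 < n" "n \<le> length x"
  shows "find_edge w (locus w x) (Nat n) = locus w (x @ [Num n])"
proof (cases "RPos w x = {}")
  case True
  then show ?thesis using locus_snoc_Null[of w x] by (simp add: locus_def)
next
  case False
  have "Z b k = Num n \<longleftrightarrow> Z b (length x) = Num n" if "length x \<le> k" for b k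
    using assms that by (cases b) auto
  then have "target w (rclass w x) (Num n) = locus w (x @ [Num n])"
    by (intro locus_snoc_stable False)
  then show ?thesis using False by (simp add: locus_def[of w x])
qed

text \<open>Several out-going edges can belong to a symbol that is new in \<open>x\<close>: the label \<open>0\<close> and the
  labels exceeding \<open>|x|\<close>. A single such edge leads to the locus of the extension. If there are
  several, the one with the least positive label leads to a node below it, whose suffix link
  points to it.\<close>

fun after_new :: "'a pvsym list \<Rightarrow> 'a val \<Rightarrow> nat \<Rightarrow> 'a val" where
  "after_new w u l = (let z = find_edge w u (Nat 0) in
     case next_label w u (Nat (Suc l)) of
       Nat n \<Rightarrow> let v = find_edge w u (Nat n) in
         if z = Null \<and> next_label w u (Nat (Suc n)) = Null then v else suf_link w v
     | _ \<Rightarrow> z)"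

lemma after_new:
  fixes w :: "'a pvsym list"
  shows "after_new w (locus w x) (length x) = locus w (x @ [Num 0])"
proof (cases "RPos w x = {}")
  case True
  then show ?thesis using locus_snoc_Null[of w x "Num 0"] by (simp add: locus_def)
next
  case False
  define U where "U = rclass w x"
  define L where "L = longest U"
  have L: "RPos w L = RPos w x" and xL: "length x \<le> length L"
    using longest_rclass[OF False] by (auto simp: L_def U_def)
  have u: "locus w x = Node U" using False by (simp add: locus_def U_def)
  define lab where "lab n \<longleftrightarrow> (\<exists>V. (U, Num n, V) \<in> edges w)" for n
  have find: "find_edge w (Node U) (Nat n) = locus w (L @ [Num n])" for n
    using False by (simp add: target_rclass U_def L_def)
  have lab: "lab n \<longleftrightarrow> RPos w (L @ [Num n]) \<noteq> {}" for n
    unfolding lab_def U_def L_def edges_iff[OF False] by blast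
  have next_Null: "next_label w (Node U) (Nat k) = Null \<longleftrightarrow> (\<forall>n\<ge>k. \<not> lab n)" for k
    by (simp add: lab_def)
  have next_Nat: "k \<le> n \<and> lab n \<and> (\<forall>n'. k \<le> n' \<and> lab n' \<longrightarrow> n \<le> n')"
    if "next_label w (Node U) (Nat k) = Nat n" for k n
  proof -
    have "\<exists>n\<ge>k. lab n" and n: "n = (LEAST n. n \<ge> k \<and> lab n)"
      using that by (auto simp: lab_def split: if_splits)
    then show ?thesis
      using LeastI_ex[of "\<lambda>n. n \<ge> k \<and> lab n"] Least_le[of "\<lambda>n. n \<ge> k \<and> lab n"] by blast
  qed
  have next_cases: "next_label w (Node U) (Nat k) = Null \<or> (\<exists>n. next_label w (Node U) (Nat k) = Nat n)" for k
    by simp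
  \<comment> \<open>A symbol that is zero under the bound \<open>k\<close> is either zero under the
    larger bound \<open>length L\<close> too or shows there as a number above \<open>k\<close>.
    Collecting positions gives \<open>new\<close>, which describes the extension of any
    \<open>y\<close> in the class by a new parameter through the edges of \<open>U\<close>.\<close>
  have Z_zero: "Z b k = Num 0 \<longleftrightarrow> Z b (length L) = Num 0 \<or> (\<exists>n>k. n \<le> length L \<and> Z b (length L) = Num n)"
    if "k \<le> length L" for b k
    using that by (cases b) auto
  have new: "RPos w (y @ [Num 0]) = RPos w (L @ [Num 0]) \<union> (\<Union>n\<in>{n. length y < n}. RPos w (L @ [Num n]))"
    if "RPos w y = RPos w x" for y
  proof -
    have yL: "length y \<le> length L" using longest_rclass(2)[OF False that] by (simp add: L_def U_def)
    have *: "Z b (length L) = Num n \<Longrightarrow> n \<le> length L" for b n by (cases b) (auto split: if_splits)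
    show ?thesis unfolding RPos_snoc that L Z_zero[OF yL] using * by blast
  qed
  show ?thesis
  proof (cases "next_label w (Node U) (Nat (Suc (length x)))")
    case Null
    then have "RPos w (L @ [Num n]) = {}" if "length x < n" for n
      using that next_Null[of "Suc (length x)"] lab[of n] by (simp add: Suc_le_eq del: next_label.simps)
    then have "RPos w (x @ [Num 0]) = RPos w (L @ [Num 0])" using new[of x] by blast
    then have "locus w (x @ [Num 0]) = locus w (L @ [Num 0])" by (rule locus_eqI)
    then show ?thesis using Null by (simp add: u find del: next_label.simps find_edge.simps)
  next
    case (Nat n)
    from next_Nat[OF this] have xn: "length x < n" and labn: "lab n"
      and least: "\<And>n'. length x < n' \<Longrightarrow> lab n' \<Longrightarrow> n \<le> n'" by (auto simp: Suc_le_eq)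
    obtain j where j: "Suc j \<in> RPos w (L @ [Num n])" "j \<in> RPos w L" "Z (w ! j) (length L) = Num n"
      "j < length w" using labn unfolding lab RPos_snoc by blast
    then have nL: "n \<le> length L" by (cases "w ! j") (auto split: if_splits)
    show ?thesis
    \<comment> \<open>In the first case \<open>n\<close> is the only usable label, so its edge ends
      at the locus itself.\<close>
    proof (cases "RPos w (L @ [Num 0]) = {} \<and> (\<forall>n'>n. \<not> lab n')")
      case True
      have eq: "RPos w (x @ [Num 0]) = RPos w (L @ [Num n])"
        unfolding new[OF refl]
      proof (intro equalityI subsetI)
        fix i assume "i \<in> RPos w (L @ [Num 0]) \<union> (\<Union>n\<in>{n. length x < n}. RPos w (L @ [Num n]))"
        then obtain n' where n': "length x < n'" "i \<in> RPos w (L @ [Num n'])" using True by auto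
        then have "lab n'" by (auto simp: lab)
        then have "n' = n" using least[OF n'(1)] True by (metis le_neq_implies_less)
        then show "i \<in> RPos w (L @ [Num n])" using n' by simp
      qed (use xn in auto)
      have "next_label w (Node U) (Nat (Suc n)) = Null"
        using True unfolding next_Null by (simp add: Suc_le_eq)
      moreover have "locus w (L @ [Num 0]) = Null" using True by (simp add: locus_def)
      ultimately show ?thesis
        using Nat locus_eqI[OF eq] by (simp add: u find del: next_label.simps find_edge.simps)
    next
      case False
      \<comment> \<open>Cutting the occurrence of \<open>L\<close> at \<open>j\<close> down to any
        length from \<open>length x\<close> on stays in the class, since the positions are caught
        between those of \<open>L\<close> and those of \<open>x\<close>.\<close>
      have mid: "RPos w (factor_at w j l) = RPos w x" "length (factor_at w j l) = l"
        if "length x \<le> l" "l \<le> length L" for l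
      proof -
        have l: "l \<le> j" "j \<le> length w" using j that by (auto simp: RPos_iff)
        then have len: "length (factor_at w j l) = l" by (rule length_factor_at)
        moreover have "j \<in> RPos w (factor_at w j l)" using l by (rule in_RPos_factor_at)
        moreover have "j \<in> RPos w x" using j(2) unfolding L .
        ultimately have "RPos w (factor_at w j l) \<subseteq> RPos w x" "RPos w L \<subseteq> RPos w (factor_at w j l)"
          using that j(2) by (simp_all add: RPos_mono)
        then show "RPos w (factor_at w j l) = RPos w x" using L by auto
        show "length (factor_at w j l) = l" by (rule len)
      qed
      \<comment> \<open>The two lengths straddle the bound: after \<open>y'\<close> the label
        \<open>n\<close> is still visible, while after \<open>y\<close>, one symbol shorter, it
        becomes 0. So removing the first symbol of \<open>y' @ [Num n]\<close> and re-encoding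
        leaves \<open>y @ [Num 0]\<close>.\<close>
      define y y' where "y = factor_at w j (n - 1)" and "y' = factor_at w j n"
      have y: "RPos w y = RPos w x" "length y = n - 1"
        using mid[of "n - 1"] xn nL by (auto simp: y_def)
      have y': "RPos w y' = RPos w x" "length y' = n"
        using mid[of n] xn nL by (auto simp: y'_def)
      have tl: "reenc (tl (y' @ [Num n])) = y @ [Num 0]"
      proof -
        have "y' \<noteq> []" using y'(2) xn by auto
        then have "reenc (tl (y' @ [Num n])) = reenc (tl y') @ [Z (Num n) (n - 1)]"
          using y'(2) by (simp add: reenc_snoc)
        moreover have "reenc (tl y') = y"
          using reenc_drop_factor_at[of "n - 1" n j w] j(2) nL xn by (simp add: y_def y'_def RPos_iff drop_Suc)
        ultimately show ?thesis using xn by simp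
      qed
      have M: "RPos w (y' @ [Num n]) = RPos w (L @ [Num n])"
      proof -
        have "Z b n = Num n \<longleftrightarrow> Z b (length L) = Num n" for b :: "'a pvsym"
          using nL xn by (cases b) auto
        then show ?thesis unfolding RPos_snoc y' L by blast
      qed
      have N: "RPos w (y @ [Num 0]) = RPos w (x @ [Num 0])"
      proof -
        \<comment> \<open>By minimality of \<open>n\<close>, no edge has a label above
          \<open>length x\<close> but below \<open>n\<close>, so the bounds of \<open>x\<close> and
          \<open>y\<close> admit the same edges.\<close>
        have empty: "RPos w (L @ [Num n']) = {}" if "length x < n'" "n' \<le> length y" for n'
        proof (rule ccontr)
          assume "RPos w (L @ [Num n']) \<noteq> {}"
          then have "n \<le> n'" using least[OF that(1)] by (simp add: lab)
          then show False using that y(2) xn by linarith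
        qed
        have "(\<Union>n'\<in>{n'. length x < n'}. RPos w (L @ [Num n'])) =
            (\<Union>n'\<in>{n'. length y < n'}. RPos w (L @ [Num n']))"
          (is "?l = ?r")
        proof
          show "?l \<subseteq> ?r"
          proof (rule UN_least)
            fix n' assume "n' \<in> {n'. length x < n'}"
            then show "RPos w (L @ [Num n']) \<subseteq> ?r"
              using empty[of n'] by (cases "length y < n'") auto
          qed
          show "?r \<subseteq> ?l" using y(2) xn by (intro UN_mono) auto
        qed
        then show ?thesis unfolding new[OF y(1)] new[OF refl] by simp
      qed
      \<comment> \<open>A second usable edge provides a position of \<open>x @ [Num 0]\<close> that
        \<open>L @ [Num n]\<close> misses, so the two classes differ and \<open>SL_rclass\<close>
        applies.\<close>
      obtain n' where n': "n' \<noteq> n" "n' = 0 \<or> n < n'" "RPos w (L @ [Num n']) \<noteq> {}"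
        using False xn lab by (metis less_irrefl less_zeroE)
      then obtain i where i: "i \<in> RPos w (L @ [Num n'])" by blast
      have "i \<notin> RPos w (L @ [Num n])" using i n' by (auto simp: RPos_snoc)
      moreover have "i \<in> RPos w (x @ [Num 0])" using i n'(2) xn unfolding new[OF refl] by auto
      ultimately have "RPos w (reenc (tl (y' @ [Num n]))) \<noteq> RPos w (y' @ [Num n])"
        unfolding tl M N by blast
      with j(1) have "SL w (rclass w (y' @ [Num n])) = rclass w (y @ [Num 0])"
        unfolding tl[symmetric] by (intro SL_rclass) (auto simp: M)
      then have SL: "SL w (rclass w (L @ [Num n])) = rclass w (x @ [Num 0])"
        using M N by (metis rclass_eq_iff)
      have "locus w (L @ [Num n]) = Node (rclass w (L @ [Num n]))"
        using j(1) by (auto simp: locus_def)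
      moreover have "locus w (x @ [Num 0]) = Node (rclass w (x @ [Num 0]))"
        using \<open>i \<in> RPos w (x @ [Num 0])\<close> by (auto simp: locus_def)
      moreover have "\<not> (locus w (L @ [Num 0]) = Null \<and> next_label w (Node U) (Nat (Suc n)) = Null)"
        using False unfolding next_Null by (auto simp: locus_def Suc_le_eq)
      ultimately show ?thesis
        using Nat SL rclass_source_iff[of w "L @ [Num n]"]
        by (auto simp: u find Let_def simp del: next_label.simps find_edge.simps)
    qed
  qed (use next_cases[of "Suc (length x)"] in \<open>auto simp del: next_label.simps\<close>)
qed


section \<open>Positions of a node and its incoming suffix links\<close>

lemma factor_at_prefix:
  assumes "reenc w = w" "i \<le> length w"
  shows "factor_at w i i = take i w"
proof (rule nth_equalityI)
  fix k assume "k < length (factor_at w i i)"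
  then have "k < i" "k < length w" using assms by (auto simp: length_factor_at)
  then show "factor_at w i i ! k = take i w ! k"
    using nth_reenc[of k w] assms(1) by (simp add: factor_at_def)
qed (use assms in \<open>simp add: length_factor_at\<close>)

text \<open>All elements of a class have the same positions; the longest serves as a canonical
  representative.\<close>

definition positions :: "'a pvsym list \<Rightarrow> 'a node \<Rightarrow> nat set" where
  "positions w U = RPos w (longest U)"

lemma positions_rclass: "RPos w x \<noteq> {} \<Longrightarrow> positions w (rclass w x) = RPos w x"
  by (simp add: positions_def longest_rclass)

lemma finite_positions [simp]: "finite (positions w U)"
  by (simp add: positions_def)

lemma node_longest:
  assumes "V \<in> nodes w"
  shows "V = rclass w (longest V)" and "positions w V \<noteq> {}"
    and "RPos w y = positions w V \<Longrightarrow> length y \<le> length (longest V)"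
proof -
  obtain x where x: "V = rclass w x" "RPos w x \<noteq> {}" using assms by (auto simp: nodes_def PFactor_iff)
  then show "V = rclass w (longest V)" "positions w V \<noteq> {}"
    using longest_rclass[OF x(2)] by (simp_all add: rclass_eq_iff positions_def)
  show "RPos w y = positions w V \<Longrightarrow> length y \<le> length (longest V)"
    using longest_rclass[OF x(2)] by (simp add: x(1) positions_def)
qed

text \<open>If the class contains the prefix of length \<open>i\<close>, then \<open>i\<close> is a
  position of the class, and no element is longer than a position. So this prefix is the longest
  element.\<close>

lemma end_pos_node:
  assumes "reenc w = w" "V \<in> nodes w"
  shows "end_pos w (Node V) =
    (if length (longest V) \<in> positions w V then Nat (length (longest V)) else Null)"
proof -
  let ?L = "longest V"
  note V = node_longest[OF assms(2)]
  have "i \<le> length w \<and> V = rclass w (take i w) \<longleftrightarrow> i = length ?L \<and> length ?L \<in> positions w V" for i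
  proof
    assume i: "i \<le> length w \<and> V = rclass w (take i w)"
    have "rclass w (take i w) = rclass w ?L" using i V(1) by simp
    then have eq: "RPos w (take i w) = positions w V" by (simp add: rclass_eq_iff positions_def)
    moreover have "i \<in> RPos w (take i w)"
      using i in_RPos_factor_at[of i i w] factor_at_prefix[OF assms(1), of i] by simp
    ultimately have iV: "i \<in> positions w V" by simp
    moreover have "i \<le> length ?L" using V(3)[OF eq] i by simp
    moreover have "length ?L \<le> i" using iV by (simp add: positions_def RPos_iff)
    ultimately show "i = length ?L \<and> length ?L \<in> positions w V" by simp
  next
    assume i: "i = length ?L \<and> length ?L \<in> positions w V"
    then have "i \<le> length w" "factor_at w i i = ?L" by (auto simp: positions_def RPos_iff)
    then show "i \<le> length w \<and> V = rclass w (take i w)"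
      using factor_at_prefix[OF assms(1), of i] V(1) by simp
  qed
  then show ?thesis by simp
qed

text \<open>A child is represented by an extension of the longest element by one symbol to the left.
  Every position of \<open>V\<close> provides one, except the length of that element, where nothing
  is left to prepend.\<close>

lemma children_eq:
  assumes "V \<in> nodes w"
  shows "{W \<in> nodes w. W \<noteq> source w \<and> SL w W = V} =
    (\<lambda>i. rclass w (factor_at w i (Suc (length (longest V))))) ` (positions w V - {length (longest V)})"
    (is "?C = ?y ` _")
proof (intro equalityI subsetI)
  let ?L = "longest V"
  note V = node_longest[OF assms]
  fix W assume "W \<in> ?C"
  then obtain z where z: "W = rclass w z" "RPos w z \<noteq> {}" and W: "W \<noteq> source w" "SL w W = V"
    unfolding nodes_def using PFactor_iff by blast
  define Y where "Y = shortest W"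
  have Y: "RPos w Y = RPos w z" by (simp add: Y_def z(1) shortest_rclass)
  have WY: "W = rclass w Y" using Y z(1) by (simp add: rclass_eq_iff)
  have "Y \<noteq> []" using W(1) by (auto simp: WY rclass_source_iff)
  have "rclass w (reenc (tl Y)) = rclass w ?L" using W(2) V(1) by (simp add: SL_def Y_def)
  then have tlY: "RPos w (reenc (tl Y)) = RPos w ?L" by (simp add: rclass_eq_iff)
  obtain i where i: "i \<in> RPos w Y" using z(2) Y by blast
  have iL: "i \<in> RPos w ?L" using RPos_reenc_tl[OF i \<open>Y \<noteq> []\<close>] tlY by simp
  have "length Y - 1 \<le> length ?L" using V(3)[of "reenc (tl Y)"] tlY by (simp add: positions_def)
  \<comment> \<open>Otherwise \<open>Y\<close> would end wherever \<open>longest V\<close> does and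
    so have the same positions as \<open>reenc (tl Y)\<close>, which is shorter, against the choice
    of \<open>Y\<close>.\<close>
  moreover have "\<not> length Y \<le> length ?L"
  proof
    assume "length Y \<le> length ?L"
    then have "RPos w ?L \<subseteq> RPos w Y" using i iL by (rule RPos_mono[rotated 2])
    moreover have "RPos w Y \<subseteq> RPos w ?L" using RPos_reenc_tl[OF _ \<open>Y \<noteq> []\<close>] tlY by blast
    ultimately have "RPos w (reenc (tl Y)) = RPos w z" using tlY Y by simp
    then have "length Y \<le> length (reenc (tl Y))"
      unfolding Y_def z(1) by (rule shortest_rclass(2))
    then show False using \<open>Y \<noteq> []\<close> by (cases Y) auto
  qed
  ultimately have lenY: "length Y = Suc (length ?L)" by simp
  have "factor_at w i (Suc (length ?L)) = Y" "i \<noteq> length ?L"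
    using i lenY by (auto simp: RPos_iff)
  then show "W \<in> ?y ` (positions w V - {length ?L})"
    using WY iL by (auto simp: positions_def)
next
  let ?L = "longest V"
  note V = node_longest[OF assms]
  fix W assume "W \<in> ?y ` (positions w V - {length ?L})"
  then obtain i where i: "i \<in> RPos w ?L" "i \<noteq> length ?L" "W = ?y i"
    by (auto simp: positions_def)
  then have l: "Suc (length ?L) \<le> i" "i \<le> length w" by (auto simp: RPos_iff)
  let ?Y = "factor_at w i (Suc (length ?L))"
  have iY: "i \<in> RPos w ?Y" using l by (rule in_RPos_factor_at)
  have lenY: "length ?Y = Suc (length ?L)" using l by (rule length_factor_at)
  have "reenc (tl ?Y) = factor_at w i (length ?L)"
    using reenc_drop_factor_at[of "length ?L" "Suc (length ?L)" i w] l by (simp add: drop_Suc)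
  then have tl: "reenc (tl ?Y) = ?L" using i(1) by (simp add: RPos_iff)
  have ne: "?Y \<noteq> []" using lenY by auto
  have "RPos w ?Y \<noteq> RPos w ?L" using V(3)[of ?Y] lenY by (auto simp: positions_def)
  then have "SL w (rclass w ?Y) = rclass w ?L"
    using SL_rclass[of w ?Y] iY ne tl by auto
  moreover have "rclass w ?Y \<in> nodes w" using iY by (intro rclass_in_nodes) auto
  ultimately show "W \<in> ?C" using i(3) V(1) ne by (simp add: rclass_source_iff)
qed

text \<open>Strings of equal length that share a position coincide, so the children split the
  positions. If none is lost, a single child would inherit all positions of \<open>V\<close>, and
  its representative would be an element of \<open>V\<close> longer than the longest.\<close>

lemma children:
  assumes "V \<in> nodes w"
  defines "C \<equiv> {W \<in> nodes w. W \<noteq> source w \<and> SL w W = V}"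
  shows finite_children: "finite C"
    and Union_children: "(\<Union>W\<in>C. positions w W) = positions w V - {length (longest V)}"
    and disjoint_children: "W \<in> C \<Longrightarrow> W' \<in> C \<Longrightarrow> W \<noteq> W' \<Longrightarrow> positions w W \<inter> positions w W' = {}"
    and two_children: "length (longest V) \<notin> positions w V \<Longrightarrow> 2 \<le> card C"
proof -
  let ?L = "longest V" and ?y = "\<lambda>i. factor_at w i (Suc (length (longest V)))"
  note V = node_longest[OF assms(1)]
  have C: "C = (\<lambda>i. rclass w (?y i)) ` (positions w V - {length ?L})"
    unfolding C_def by (rule children_eq[OF assms(1)])
  show fin: "finite C" unfolding C by simp
  have y: "i \<in> RPos w (?y i)" "length (?y i) = Suc (length ?L)" "positions w (rclass w (?y i)) = RPos w (?y i)"
    "RPos w (?y i) \<subseteq> positions w V - {length ?L}"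
    if i: "i \<in> positions w V - {length ?L}" for i
  proof -
    have l: "Suc (length ?L) \<le> i" "i \<le> length w" using i by (auto simp: RPos_iff positions_def)
    show iY: "i \<in> RPos w (?y i)" using l by (rule in_RPos_factor_at)
    show len: "length (?y i) = Suc (length ?L)" using l by (rule length_factor_at)
    show "positions w (rclass w (?y i)) = RPos w (?y i)" using iY by (intro positions_rclass) auto
    have "RPos w (?y i) \<subseteq> positions w V"
      unfolding positions_def using i iY len by (intro RPos_mono[of i]) (auto simp: positions_def)
    moreover have "length ?L \<notin> RPos w (?y i)" using len by (auto simp: RPos_iff)
    ultimately show "RPos w (?y i) \<subseteq> positions w V - {length ?L}" by blast
  qed
  show Un: "(\<Union>W\<in>C. positions w W) = positions w V - {length ?L}"
  proof (intro equalityI subsetI)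
    fix i assume "i \<in> positions w V - {length ?L}"
    then show "i \<in> (\<Union>W\<in>C. positions w W)"
      using y(1,3)[of i] unfolding C by blast
  next
    fix i assume "i \<in> (\<Union>W\<in>C. positions w W)"
    then show "i \<in> positions w V - {length ?L}"
      unfolding C using y(3,4) by blast
  qed
  show "positions w W \<inter> positions w W' = {}" if W: "W \<in> C" "W' \<in> C" "W \<noteq> W'" for W W'
  proof (rule ccontr)
    assume "positions w W \<inter> positions w W' \<noteq> {}"
    then obtain k where k: "k \<in> positions w W" "k \<in> positions w W'" by blast
    from W obtain i j where i: "i \<in> positions w V - {length ?L}" "W = rclass w (?y i)"
      and j: "j \<in> positions w V - {length ?L}" "W' = rclass w (?y j)" unfolding C by blast
    have "?y i = ?y j"
      using k y(2,3)[OF i(1)] y(2,3)[OF j(1)] i(2) j(2) by (intro RPos_eq_if_length_eq[of k w]) auto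
    then show False using W(3) i j by simp
  qed
  show "2 \<le> card C" if no: "length ?L \<notin> positions w V"
  proof (rule ccontr)
    assume "\<not> 2 \<le> card C"
    moreover obtain i where i: "i \<in> positions w V" using V(2) by blast
    then have iC: "rclass w (?y i) \<in> C" using no unfolding C by auto
    then have "card C \<noteq> 0" using fin by auto
    ultimately have "card C = 1" by simp
    then have "C = {rclass w (?y i)}" using iC by (auto simp: card_1_singleton_iff)
    then have "RPos w (?y i) = positions w V"
      using Un no y(3)[of i] i by auto
    then have "length (?y i) \<le> length ?L" by (rule V(3))
    then show False using y(2)[of i] i no by auto
  qed
qed

text \<open>\<open>b\<close> counts the position of \<open>V\<close> that no child inherits. The
  last claim says linearly that there are at least two links unless \<open>b = 1\<close>, the form
  used in the time analysis.\<close>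

lemma inlinks_node:
  assumes "lists_inlinks w ls" "V \<in> nodes w"
  defines "b \<equiv> (if length (longest V) \<in> positions w V then 1 else 0 :: nat)"
  shows set_inlinks_subset: "set (ls V) \<subseteq> nodes w"
    and Union_inlinks: "(\<Union>W\<in>set (ls V). positions w W) = positions w V - {length (longest V)}"
    and sum_list_inlinks: "(\<Sum>W\<leftarrow>ls V. card (positions w W)) + b = card (positions w V)"
    and length_inlinks: "2 \<le> length (ls V) + 2 * b"
proof -
  let ?C = "{W \<in> nodes w. W \<noteq> source w \<and> SL w W = V}"
  have ls: "distinct (ls V)" "set (ls V) = ?C" using assms(1,2) by (auto simp: lists_inlinks_def)
  note ch = children[OF assms(2)]
  show "set (ls V) \<subseteq> nodes w" using ls by auto
  show "(\<Union>W\<in>set (ls V). positions w W) = positions w V - {length (longest V)}"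
    unfolding ls(2) by (rule ch(2))
  have "(\<Sum>W\<leftarrow>ls V. card (positions w W)) = (\<Sum>W\<in>?C. card (positions w W))"
    using ls by (simp add: sum_list_distinct_conv_sum_set)
  also have "\<dots> = card (\<Union>W\<in>?C. positions w W)"
    using ch(1,3) by (subst card_UN_disjoint) auto
  also have "\<dots> = card (positions w V - {length (longest V)})" unfolding ch(2) ..
  finally have sum: "(\<Sum>W\<leftarrow>ls V. card (positions w W)) = card (positions w V - {length (longest V)})" .
  show "(\<Sum>W\<leftarrow>ls V. card (positions w W)) + b = card (positions w V)"
    unfolding sum b_def
    using card_Suc_Diff1[OF finite_positions, of "length (longest V)" w V] by (simp del: card_Diff_insert)
  have "length (ls V) = card ?C" using ls distinct_card by metis
  then show "2 \<le> length (ls V) + 2 * b" using ch(4) by (auto simp: b_def)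
qed


section \<open>The algorithm and its running time\<close>

text \<open>A total-correctness predicate whose postcondition also sees the running time. Its rules
  for loop-free code are equations, so that the simplifier executes such code symbolically.\<close>

definition run :: "'a env \<Rightarrow> com \<Rightarrow> 'a state \<Rightarrow> (nat \<Rightarrow> 'a state \<Rightarrow> bool) \<Rightarrow> bool" where
  "run e c s Q \<longleftrightarrow> (\<exists>t s'. exec e c s t s' \<and> Q t s')"

lemma run_mono: "run e c s Q \<Longrightarrow> (\<And>t s'. Q t s' \<Longrightarrow> Q' t s') \<Longrightarrow> run e c s Q'"
  by (auto simp: run_def)

lemma run_Skip [simp]: "run e Skip s Q \<longleftrightarrow> Q 1 s"
  unfolding run_def by (metis SkipE exec.Skip)

lemma run_Do [simp]: "run e (Do i) s Q \<longleftrightarrow> Q (cost e i) (step e i s)"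
  unfolding run_def by (metis DoE exec.Do)

lemma run_Seq [simp]: "run e (Seq c1 c2) s Q \<longleftrightarrow> run e c1 s (\<lambda>t s'. run e c2 s' (\<lambda>u. Q (t + u)))"
  unfolding run_def by (blast intro: exec.Seq elim: SeqE)

lemma run_If [simp]:
  "run e (If b c1 c2) s Q \<longleftrightarrow> run e (if holds e b s then c1 else c2) s (\<lambda>t. Q (1 + t))"
proof -
  have "exec e (If b c1 c2) s t s' \<longleftrightarrow> (\<exists>u. t = 1 + u \<and> exec e (if holds e b s then c1 else c2) s u s')" for t s'
  proof
    assume "exec e (If b c1 c2) s t s'"
    then show "\<exists>u. t = 1 + u \<and> exec e (if holds e b s then c1 else c2) s u s'" by (rule IfE) simp_all
  next
    assume "\<exists>u. t = 1 + u \<and> exec e (if holds e b s then c1 else c2) s u s'"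
    then obtain u where u: "t = 1 + u" "exec e (if holds e b s then c1 else c2) s u s'" by blast
    show "exec e (If b c1 c2) s t s'"
    proof (cases "holds e b s")
      case True
      then show ?thesis unfolding u(1) by (rule exec.IfTrue) (use u(2) True in simp)
    next
      case False
      then show ?thesis unfolding u(1) by (rule exec.IfFalse) (use u(2) False in simp)
    qed
  qed
  then show ?thesis unfolding run_def by auto
qed

text \<open>The first argument of the invariant bounds the time that remains.\<close>

lemma run_While:
  assumes "I n s"
    and body: "\<And>n s. I n s \<Longrightarrow> holds e b s \<Longrightarrow> run e c s (\<lambda>t s'. \<exists>n'. I n' s' \<and> t + 1 + n' \<le> n)"
  shows "run e (While b c) s (\<lambda>t s'. \<exists>n'. I n' s' \<and> \<not> holds e b s' \<and> t + n' \<le> n + 1)"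
  using assms(1)
proof (induction n arbitrary: s rule: less_induct)
  case (less n)
  show ?case
  proof (cases "holds e b s")
    case True
    from body[OF less.prems this] obtain t s' n' where
      1: "exec e c s t s'" "I n' s'" "t + 1 + n' \<le> n" by (auto simp: run_def)
    with less.IH[of n' s'] obtain t' s'' n'' where
      "exec e (While b c) s' t' s''" "I n'' s''" "\<not> holds e b s''" "t' + n'' \<le> n' + 1"
      by (auto simp: run_def)
    with 1 True show ?thesis
      unfolding run_def
      by (intro exI[of _ "1 + t + t'"] exI[of _ s''] conjI exec.WhileTrue[of e b s c t s'] exI[of _ n'']) auto
  next
    case False
    then show ?thesis
      unfolding run_def using less.prems
      by (intro exI[of _ "1"] exI[of _ s] conjI exec.WhileFalse exI[of _ n]) auto
  qed
qed

primrec block :: "com list \<Rightarrow> com" where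
  "block [] = Skip"
| "block (c # cs) = Seq c (block cs)"

section \<open>Registers and program\<close>

abbreviation (input) r_zero :: reg where "r_zero \<equiv> 0"
abbreviation (input) r_one :: reg where "r_one \<equiv> 1"
abbreviation (input) r_len :: reg where "r_len \<equiv> 2"
abbreviation (input) r_i :: reg where "r_i \<equiv> 3"
abbreviation (input) r_node :: reg where "r_node \<equiv> 4"
abbreviation (input) r_sym :: reg where "r_sym \<equiv> 5"
abbreviation (input) r_last :: reg where "r_last \<equiv> 6"
abbreviation (input) r_key :: reg where "r_key \<equiv> 7"
abbreviation (input) r_label :: reg where "r_label \<equiv> 8"
abbreviation (input) r_edge0 :: reg where "r_edge0 \<equiv> 9"
abbreviation (input) r_below :: reg where "r_below \<equiv> 10"
abbreviation (input) r_sp :: reg where "r_sp \<equiv> 11"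
abbreviation (input) r_cur :: reg where "r_cur \<equiv> 12"
abbreviation (input) r_pos :: reg where "r_pos \<equiv> 13"
abbreviation (input) r_q :: reg where "r_q \<equiv> 14"
abbreviation (input) r_child :: reg where "r_child \<equiv> 15"

text \<open>The program for \<open>after_new\<close>: \<open>r_edge0\<close> holds its
  \<open>z\<close> and \<open>r_below\<close> its \<open>v\<close>; the nested conditionals express
  the conjunction of its null tests.\<close>

definition extend_new :: com where
  "extend_new = block [
     Do (FindEdge r_edge0 r_node r_zero),
     Do (Add r_key r_i r_one),
     Do (NextLabel r_label r_node r_key),
     If (IsNull r_label) (Do (Move r_node r_edge0)) (block [
       Do (FindEdge r_below r_node r_label),
       Do (Add r_key r_label r_one),
       Do (NextLabel r_label r_node r_key),
       If (IsNull r_edge0) (If (IsNull r_label) Skip (Do (SufLink r_below r_below)))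
         (Do (SufLink r_below r_below)),
       Do (Move r_node r_below)])]"

definition read_symbol :: com where
  "read_symbol = block [
     Do (PatSym r_sym r_i),
     If (IsStatic r_sym) (Do (FindEdge r_node r_node r_sym)) (block [
       Do (TabGet r_last r_sym),
       If (IsNull r_last) extend_new
         (block [Do (Sub r_key r_i r_last), Do (FindEdge r_node r_node r_key)]),
       Do (TabPut r_sym r_i)]),
     Do (Add r_i r_i r_one)]"

definition push_child :: com where
  "push_child = block [
     Do (Store r_sp r_child),
     Do (Add r_sp r_sp r_one),
     Do (Add r_q r_q r_one),
     Do (InLink r_child r_cur r_q)]"

definition push_children :: com where
  "push_children = block [
     Do (Const r_q 0),
     Do (InLink r_child r_cur r_q),
     While (Not (IsNull r_child)) push_child]"

text \<open>The position stored at a node is an end, so subtracting the pattern length gives the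
  start of the occurrence.\<close>

definition pop :: com where
  "pop = block [
     Do (Sub r_sp r_sp r_one),
     Do (Load r_cur r_sp),
     Do (EndPos r_pos r_cur),
     If (IsNull r_pos) Skip (block [Do (Sub r_pos r_pos r_len), Do (Report r_pos)])]"

definition report_subtree :: com where
  "report_subtree = If (IsNull r_node) Skip (block [
     Do (Const r_sp 0),
     Do (Store r_sp r_node),
     Do (Const r_sp 1),
     While (Less r_zero r_sp) (Seq pop push_children)])"

definition find_all :: com where
  "find_all = block [
     Do (Const r_zero 0),
     Do (Const r_one 1),
     Do (PatLen r_len),
     Do (Const r_i 0),
     Do (Source r_node),
     While (Less r_i r_len) read_symbol,
     report_subtree]"

section \<open>Reading the pattern\<close>

lemma next_label_cases: "next_label w u k = Null \<or> (\<exists>n. next_label w u k = Nat n)"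
  by (cases "(w, u, k)" rule: next_label.cases) auto

text \<open>At most four searches are made. The registers asserted unchanged are the constants, the
  index, and the symbol still to be entered in the table.\<close>

lemma run_extend_new:
  assumes "regs s r_zero = Nat 0" "regs s r_one = Nat 1" "regs s r_i = Nat l"
  shows "run e extend_new s (\<lambda>t s'. t \<le> 15 + 4 * search_cost e \<and>
    regs s' r_node = after_new (encoded e) (regs s r_node) l \<and>
    (\<forall>r. r < r_node \<or> r = r_sym \<longrightarrow> regs s' r = regs s r) \<and> tab s' = tab s \<and> out s' = out s)"
  using next_label_cases[of "encoded e" "regs s r_node" "Nat (Suc l)"] assms
  by (auto simp: extend_new_def Let_def simp del: next_label.simps find_edge.simps suf_link.simps)

text \<open>Static symbols are never entered in the table, so only the others are
  constrained.\<close>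

definition last_seen :: "'a set \<Rightarrow> 'a list \<Rightarrow> ('a \<Rightarrow> 'a val) \<Rightarrow> bool" where
  "last_seen \<Sigma> S f \<longleftrightarrow> (\<forall>x. x \<notin> \<Sigma> \<longrightarrow>
     f x = (if x \<in> set S then Nat (Max {j. j < length S \<and> S ! j = x}) else Null))"

lemma prev_snoc:
  "prev \<Sigma> (S @ [a]) = prev \<Sigma> S @ [if a \<in> \<Sigma> then Stat a else if a \<notin> set S then Num 0
     else Num (length S - Max {j. j < length S \<and> S ! j = a})]"
proof -
  have "prev \<Sigma> (S @ [a]) = take (length S) (prev \<Sigma> (S @ [a])) @ [prev \<Sigma> (S @ [a]) ! length S]"
    by (metis length_append_singleton length_prev lessI take_Suc_conv_app_nth take_all_iff order_refl)
  also have "take (length S) (prev \<Sigma> (S @ [a])) = prev \<Sigma> S"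
    using prev_take[of \<Sigma> "length S" "S @ [a]"] by simp
  also have "{j. j < length S \<and> (S @ [a]) ! j = a} = {j. j < length S \<and> S ! j = a}"
    by (auto simp: nth_append)
  then have "prev \<Sigma> (S @ [a]) ! length S = (if a \<in> \<Sigma> then Stat a else if a \<notin> set S then Num 0
     else Num (length S - Max {j. j < length S \<and> S ! j = a}))"
    by (simp add: prev_def del: upt_Suc)
  finally show ?thesis .
qed

lemma last_seen_snoc:
  assumes "last_seen \<Sigma> S f"
  shows "last_seen \<Sigma> (S @ [a]) (f(a := Nat (length S)))"
    and "a \<in> \<Sigma> \<Longrightarrow> last_seen \<Sigma> (S @ [a]) f"
proof -
  have max: "Max {j. j < length (S @ [a]) \<and> (S @ [a]) ! j = a} = length S"
    by (rule Max_eqI) auto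
  have sets: "{j. j < length (S @ [a]) \<and> (S @ [a]) ! j = x} = {j. j < length S \<and> S ! j = x}"
    if "x \<noteq> a" for x
    using that by (auto simp: nth_append less_Suc_eq)
  have "last_seen \<Sigma> (S @ [a]) g" if "\<And>x. x \<noteq> a \<Longrightarrow> g x = f x"
    "a \<notin> \<Sigma> \<Longrightarrow> g a = Nat (length S)" for g
    unfolding last_seen_def
  proof (intro allI impI)
    fix x assume "x \<notin> \<Sigma>"
    then show "g x = (if x \<in> set (S @ [a]) then
        Nat (Max {j. j < length (S @ [a]) \<and> (S @ [a]) ! j = x}) else Null)"
      using assms that max sets[of x]
      by (cases "x = a") (simp_all only: last_seen_def, simp_all)
  qed
  then show "last_seen \<Sigma> (S @ [a]) (f(a := Nat (length S)))"
    and "a \<in> \<Sigma> \<Longrightarrow> last_seen \<Sigma> (S @ [a]) f" by simp_all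
qed

definition search_inv :: "'a env \<Rightarrow> nat \<Rightarrow> 'a state \<Rightarrow> bool" where
  "search_inv e n s \<longleftrightarrow> n \<le> length (pattern e) \<and>
     regs s r_zero = Nat 0 \<and> regs s r_one = Nat 1 \<and> regs s r_len = Nat (length (pattern e)) \<and>
     regs s r_i = Nat n \<and>
     regs s r_node = locus (encoded e) (prev (statics e) (take n (pattern e))) \<and>
     last_seen (statics e) (take n (pattern e)) (tab s) \<and> out s = []"

text \<open>The worst case is a new parameter, with four searches in \<open>extend_new\<close> and
  two in the table.\<close>

lemma run_read_symbol:
  assumes inv: "search_inv e n s" and n: "n < length (pattern e)"
  shows "run e read_symbol s (\<lambda>t s'. search_inv e (Suc n) s' \<and> t \<le> 25 + 6 * search_cost e)"
proof -
  define S a where "S = take n (pattern e)" and "a = pattern e ! n"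
  have S: "take (Suc n) (pattern e) = S @ [a]" "length S = n"
    using n by (simp_all add: S_def a_def take_Suc_conv_app_nth)
  note inv' = inv[unfolded search_inv_def, folded S_def]
  have sym: "pat_sym (pattern e) (Nat n) = Sym a" using n by (simp add: a_def)
  show ?thesis
  proof (cases "a \<in> statics e")
    case True
    have "find_edge (encoded e) (regs s r_node) (Sym a) = locus (encoded e) (prev (statics e) (S @ [a]))"
      using inv' True by (simp add: find_edge_static prev_snoc)
    then show ?thesis
      using inv' True n last_seen_snoc(2)[of "statics e" S "tab s" a]
      by (simp add: read_symbol_def sym search_inv_def S del: pat_sym.simps find_edge.simps)
  next
    case False
    then have last: "tab s a = (if a \<in> set S then Nat (Max {j. j < length S \<and> S ! j = a}) else Null)"
      using inv' by (simp add: last_seen_def)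
    note snoc = last_seen_snoc(1)[of "statics e" S "tab s" a]
    show ?thesis
    proof (cases "a \<in> set S")
      case True
      define j where "j = Max {j. j < length S \<and> S ! j = a}"
      have "{j. j < length S \<and> S ! j = a} \<noteq> {}" using True by (auto simp: in_set_conv_nth)
      \<comment> \<open>\<open>find_edge_repeat\<close> requires \<open>n - j\<close> to be positive
        and at most \<open>n\<close>, the length read so far.\<close>
      from Max_in[OF _ this] have "j < n" using S by (simp add: j_def)
      then have "find_edge (encoded e) (regs s r_node) (Nat (n - j)) = locus (encoded e) (prev (statics e) (S @ [a]))"
        using inv' True False find_edge_repeat[of "n - j" "prev (statics e) S"] S
        by (simp add: prev_snoc j_def)
      then show ?thesis
        using inv' True False n snoc last[folded j_def]
        by (simp add: read_symbol_def sym search_inv_def S del: pat_sym.simps find_edge.simps)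
    next
      case new: False
      have after: "after_new (encoded e) (regs s r_node) n = locus (encoded e) (prev (statics e) (S @ [a]))"
        using inv' False new after_new[of "encoded e" "prev (statics e) S"] S
        by (simp add: prev_snoc del: after_new.simps)
      let ?s = "set_reg (set_reg s r_sym (Sym a)) r_last Null"
      have "run e extend_new ?s (\<lambda>t s'. t \<le> 15 + 4 * search_cost e \<and>
          regs s' r_node = locus (encoded e) (prev (statics e) (S @ [a])) \<and>
          (\<forall>r. r < r_node \<or> r = r_sym \<longrightarrow> regs s' r = regs ?s r) \<and> tab s' = tab s \<and> out s' = out s)"
        by (rule run_mono[OF run_extend_new[of ?s n e]])
          (use inv' after in \<open>simp_all del: after_new.simps\<close>)
      from run_mono[OF this] show ?thesis
        using inv' new False n snoc last
        by (simp add: read_symbol_def sym search_inv_def S del: pat_sym.simps find_edge.simps)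
    qed
  qed
qed

section \<open>Traversal of the suffix link subtree\<close>

definition frame :: "'a state \<Rightarrow> 'a state \<Rightarrow> bool" where
  "frame s s' \<longleftrightarrow> (\<forall>r \<le> r_len. regs s' r = regs s r)"

text \<open>Each child costs five steps in \<open>push_child\<close> and one for the loop test,
  whence the factor 6.\<close>

lemma run_push_children:
  fixes e :: "'a env"
  assumes "regs s r_sp = Nat p" "regs s r_one = Nat 1" "regs s r_cur = Node V"
  defines "ls \<equiv> inlinks e V"
  shows "run e push_children s (\<lambda>t s'. t \<le> 4 + 6 * length ls \<and> frame s s' \<and> out s' = out s \<and>
    regs s' r_sp = Nat (p + length ls) \<and> (\<forall>j<p. mem s' j = mem s j) \<and>
    (\<forall>j<length ls. mem s' (p + j) = Node (ls ! j)))"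
proof -
  define I where "I n s' \<longleftrightarrow> (\<exists>q. q \<le> length ls \<and> n = 6 * (length ls - q) \<and>
    frame s s' \<and> out s' = out s \<and> regs s' r_cur = Node V \<and> regs s' r_q = Nat q \<and>
    regs s' r_child = (if q < length ls then Node (ls ! q) else Null) \<and>
    regs s' r_sp = Nat (p + q) \<and> (\<forall>j<p. mem s' j = mem s j) \<and>
    (\<forall>j<q. mem s' (p + j) = Node (ls ! j)))" for n s'
  let ?b = "Not (IsNull r_child)"
  let ?s = "step e (InLink r_child r_cur r_q) (step e (Const r_q 0) s)"
  have "I (6 * length ls) ?s"
    using assms by (auto simp: I_def frame_def)
  then have "run e (While ?b push_child) ?s (\<lambda>t s'. \<exists>n'. I n' s' \<and> \<not> holds e ?b s' \<and> t + n' \<le> 6 * length ls + 1)"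
  proof (rule run_While)
    fix n s' assume I: "I n s'" and b: "holds e ?b s'"
    from I obtain q where q: "q \<le> length ls" "n = 6 * (length ls - q)" "frame s s'" "out s' = out s"
      "regs s' r_cur = Node V" "regs s' r_q = Nat q"
      "regs s' r_child = (if q < length ls then Node (ls ! q) else Null)"
      "regs s' r_sp = Nat (p + q)" "\<forall>j<p. mem s' j = mem s j" "\<forall>j<q. mem s' (p + j) = Node (ls ! j)"
      unfolding I_def by blast
    have ql: "q < length ls" using b q(7) by (auto split: if_splits)
    moreover have "regs s' r_one = Nat 1" using q(3) assms(2) by (simp add: frame_def)
    ultimately have "run e push_child s' (\<lambda>t s''. I (6 * (length ls - Suc q)) s'' \<and> t = 5)"
      using q unfolding I_def
      by (simp add: push_child_def frame_def ls_def less_Suc_eq)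
    then show "run e push_child s' (\<lambda>t s'. \<exists>n'. I n' s' \<and> t + 1 + n' \<le> n)"
      by (rule run_mono) (use q(2) ql in auto)
  qed
  then show ?thesis
    unfolding push_children_def block.simps run_Seq run_Do run_Skip
    by (rule run_mono) (auto simp: I_def split: if_splits)
qed


text \<open>The last element of the list is the top of the stack.\<close>

definition stack :: "'a node list \<Rightarrow> nat \<Rightarrow> 'a state \<Rightarrow> bool" where
  "stack st m s \<longleftrightarrow> regs s r_zero = Nat 0 \<and> regs s r_one = Nat 1 \<and> regs s r_len = Nat m \<and>
     regs s r_sp = Nat (length st) \<and> (\<forall>j<length st. mem s j = Node (st ! j))"

lemma run_visit:
  assumes st: "stack (st @ [V]) m s" and V: "reenc (encoded e) = encoded e" "V \<in> nodes (encoded e)"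
  defines "l \<equiv> length (longest V)"
  shows "run e (Seq pop push_children) s (\<lambda>t s'. t \<le> 12 + 6 * length (inlinks e V) \<and> stack (st @ inlinks e V) m s' \<and>
    out s' = out s @ (if l \<in> positions (encoded e) V then [l - m] else []))"
proof -
  have e: "end_pos (encoded e) (Node V) = (if l \<in> positions (encoded e) V then Nat l else Null)"
    unfolding l_def by (rule end_pos_node[OF V])
  have push: "run e push_children s0 (\<lambda>t s'. t \<le> 4 + 6 * length (inlinks e V) \<and>
      stack (st @ inlinks e V) m s' \<and> out s' = out s0)"
    if "stack st m s0" "regs s0 r_cur = Node V" for s0
  proof (rule run_mono[OF run_push_children[of s0 "length st" V e]])
    show "regs s0 r_sp = Nat (length st)" "regs s0 r_one = Nat 1" "regs s0 r_cur = Node V"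
      using that by (simp_all add: stack_def)
    fix t s'
    assume s': "t \<le> 4 + 6 * length (inlinks e V) \<and> frame s0 s' \<and> out s' = out s0 \<and>
      regs s' r_sp = Nat (length st + length (inlinks e V)) \<and> (\<forall>j<length st. mem s' j = mem s0 j) \<and>
      (\<forall>j<length (inlinks e V). mem s' (length st + j) = Node (inlinks e V ! j))"
    have "mem s' j = Node ((st @ inlinks e V) ! j)" if "j < length st + length (inlinks e V)" for j
    proof (cases "j < length st")
      case True
      then show ?thesis using s' \<open>stack st m s0\<close> by (simp add: stack_def nth_append)
    next
      case False
      then obtain k where "j = length st + k" using le_Suc_ex by (metis not_less)
      then show ?thesis using that s' by (simp add: nth_append)
    qed
    then show "t \<le> 4 + 6 * length (inlinks e V) \<and> stack (st @ inlinks e V) m s' \<and> out s' = out s0"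
      using s' that by (simp add: stack_def frame_def)
  qed
  have mem: "mem s (length st) = Node V" using st by (simp add: stack_def)
  have "run e pop s (\<lambda>t s'. t \<le> 8 \<and> stack st m s' \<and> regs s' r_cur = Node V \<and>
      out s' = out s @ (if l \<in> positions (encoded e) V then [l - m] else []))"
    using st mem by (auto simp: pop_def e stack_def nth_append simp del: end_pos.simps)
  then show ?thesis
    unfolding run_Seq
    by (rule run_mono) (elim conjE, rule run_mono[OF push], auto)
qed

lemma run_report_subtree:
  fixes e :: "'a env"
  assumes w: "reenc (encoded e) = encoded e" "lists_inlinks (encoded e) (inlinks e)"
    and s: "regs s r_zero = Nat 0" "regs s r_one = Nat 1" "regs s r_len = Nat m"
      "regs s r_node = locus (encoded e) x" "out s = []"
  defines "R \<equiv> RPos (encoded e) x"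
  assumes inj: "inj_on (\<lambda>i. i - m) R"
  shows "run e report_subtree s (\<lambda>t s'. t \<le> 10 + 40 * card R \<and> distinct (out s') \<and>
    set (out s') = (\<lambda>i. i - m) ` R)"
proof (cases "R = {}")
  case True
  then show ?thesis using s by (simp add: report_subtree_def locus_def R_def)
next
  case False
  let ?w = "encoded e"
  let ?V = "rclass ?w x"
  let ?size = "\<lambda>st. \<Sum>V\<leftarrow>st. card (positions ?w V)"
  \<comment> \<open>Visiting a node with \<open>k\<close> children costs at most \<open>13 + 6 * k\<close>. The cardinalities of the
    children add up to that of the node, or to one less if the node has a position of its own;
    lowering each by one lets a node without such a position, where \<open>k \<ge> 2\<close>, release \<open>40 * (k - 1)\<close>.\<close>
  define pot where "pot st = (\<Sum>V\<leftarrow>st. 40 * (card (positions ?w V) - 1) + 13)" for st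
  \<comment> \<open>Distinctness will follow by counting: once the stack is empty, the output has
    length \<open>card R\<close> and its set has \<open>card R\<close> elements. Hence covering and
    an exact count suffice as an invariant.\<close>
  define I where "I n s' \<longleftrightarrow> (\<exists>st. n = pot st \<and> stack st m s' \<and> set st \<subseteq> nodes ?w \<and>
    set (out s') \<union> (\<Union>V\<in>set st. (\<lambda>i. i - m) ` positions ?w V) = (\<lambda>i. i - m) ` R \<and>
    length (out s') + ?size st = card R)" for n s'
  let ?s = "step e (Const r_sp 1) (step e (Store r_sp r_node) (step e (Const r_sp 0) s))"
  let ?b = "Less r_zero r_sp"
  have node: "regs s r_node = Node ?V" and V: "?V \<in> nodes ?w"
    using s False by (simp_all add: locus_def R_def rclass_in_nodes)
  have posV: "positions ?w ?V = R" using False by (simp add: R_def positions_rclass)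
  have "I (pot [?V]) ?s"
    unfolding I_def using s node V posV by (intro exI[of _ "[?V]"]) (simp add: stack_def)
  then have "run e (While ?b (Seq pop push_children)) ?s (\<lambda>t s'. \<exists>n'. I n' s' \<and> \<not> holds e ?b s' \<and> t + n' \<le> pot [?V] + 1)"
  proof (rule run_While)
    fix n s' assume "I n s'" and b: "holds e ?b s'"
    then obtain st where st: "n = pot st" "stack st m s'" "set st \<subseteq> nodes ?w"
      "set (out s') \<union> (\<Union>V\<in>set st. (\<lambda>i. i - m) ` positions ?w V) = (\<lambda>i. i - m) ` R"
      "length (out s') + ?size st = card R" unfolding I_def by blast
    have "st \<noteq> []" using b st(2) by (auto simp: stack_def)
    then obtain st' V where st': "st = st' @ [V]" by (metis rev_exhaust)
    have V: "V \<in> nodes ?w" using st(3) st' by simp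
    let ?ls = "inlinks e V"
    define l where "l = length (longest V)"
    note in_ls = inlinks_node[OF w(2) V, folded l_def]
    have card_pos: "0 < card (positions ?w W)" if "W \<in> nodes ?w" for W
      using node_longest(2)[OF that] by (simp add: card_gt_0_iff)
    \<comment> \<open>A node with \<open>c > 0\<close> positions weighs
      \<open>40 * c - 27\<close>.\<close>
    have pot_ls: "pot ?ls + 27 * length ?ls = 40 * ?size ?ls" if "set ?ls \<subseteq> nodes ?w"
    proof -
      have "pot Ws + 27 * length Ws = 40 * ?size Ws" if "set Ws \<subseteq> nodes ?w" for Ws
        using that
      proof (induction Ws)
        case (Cons W Ws)
        then show ?case using card_pos[of W] by (simp add: pot_def)
      qed (simp add: pot_def)
      then show ?thesis using that .
    qed
    have pot_V: "pot st = pot st' + (40 * (card (positions ?w V) - 1) + 13)"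
      by (simp add: pot_def st')
    have pot_app: "pot (st' @ ?ls) = pot st' + pot ?ls" by (simp add: pot_def)
    show "run e (Seq pop push_children) s' (\<lambda>t s''. \<exists>n'. I n' s'' \<and> t + 1 + n' \<le> n)"
    proof (rule run_mono[OF run_visit[OF st(2)[unfolded st'] w(1) V, folded l_def]])
      fix t s''
      assume s'': "t \<le> 12 + 6 * length ?ls \<and> stack (st' @ ?ls) m s'' \<and>
        out s'' = out s' @ (if l \<in> positions ?w V then [l - m] else [])"
      have "I (pot (st' @ ?ls)) s''"
        unfolding I_def
      proof (intro exI[of _ "st' @ ?ls"] conjI refl)
        show "stack (st' @ ?ls) m s''" using s'' by simp
        show "set (st' @ ?ls) \<subseteq> nodes ?w" using in_ls(1) st(3) st' by simp
        let ?f = "\<lambda>V. (\<lambda>i. i - m) ` positions ?w V"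
        let ?A = "if l \<in> positions ?w V then {l - m} else {}"
        have f: "?f V = ?A \<union> \<Union> (?f ` set ?ls)"
          using arg_cong[OF in_ls(2), of "image (\<lambda>i. i - m)"] by (auto simp: image_UN)
        have "set (out s'') \<union> \<Union> (?f ` set (st' @ ?ls))
            = set (out s') \<union> (\<Union> (?f ` set st') \<union> (?A \<union> \<Union> (?f ` set ?ls)))"
          using s'' by (simp add: Un_ac)
        also have "\<dots> = set (out s') \<union> \<Union> (?f ` set st)"
          unfolding f[symmetric] st' by (simp add: Un_ac)
        also note st(4)
        finally show "set (out s'') \<union> \<Union> (?f ` set (st' @ ?ls)) = (\<lambda>i. i - m) ` R" .
        show "length (out s'') + ?size (st' @ ?ls) = card R"
          using s'' st(5) in_ls(3) by (auto simp: st')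
      qed
      \<comment> \<open>Let \<open>k\<close> be the number of children, and let \<open>b\<close> be
        1 if \<open>l\<close> is a position of \<open>V\<close> and 0 otherwise. It suffices that
        \<open>40 \<le> 40 * b + 21 * k\<close>, which holds since \<open>b = 0\<close> forces
        \<open>2 \<le> k\<close>.\<close>
      moreover have "t + 1 + pot (st' @ ?ls) \<le> n"
        using s'' in_ls(3,4) pot_ls[OF in_ls(1)] card_pos[OF V]
        unfolding st(1) pot_V pot_app by (auto split: if_splits)
      ultimately show "\<exists>n'. I n' s'' \<and> t + 1 + n' \<le> n" by blast
    qed
  qed
  then have loop: "run e (While ?b (Seq pop push_children)) ?s (\<lambda>t s'. t \<le> pot [?V] + 1 \<and> distinct (out s') \<and>
      set (out s') = (\<lambda>i. i - m) ` R)"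
  proof (rule run_mono)
    fix t s' assume "\<exists>n'. I n' s' \<and> \<not> holds e ?b s' \<and> t + n' \<le> pot [?V] + 1"
    then obtain n' st where n': "\<not> holds e ?b s'" "t + n' \<le> pot [?V] + 1" and st: "stack st m s'"
      "set (out s') \<union> (\<Union>V\<in>set st. (\<lambda>i. i - m) ` positions ?w V) = (\<lambda>i. i - m) ` R"
      "length (out s') + ?size st = card R" unfolding I_def by blast
    have "st = []" using n'(1) st(1) by (simp add: stack_def)
    then have "set (out s') = (\<lambda>i. i - m) ` R" "length (out s') = card R" using st by simp_all
    moreover have "card ((\<lambda>i. i - m) ` R) = card R" using inj by (rule card_image)
    ultimately show "t \<le> pot [?V] + 1 \<and> distinct (out s') \<and> set (out s') = (\<lambda>i. i - m) ` R"
      using n'(2) by (simp add: card_distinct)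
  qed
  have "card R \<noteq> 0" using False by (simp add: R_def)
  then have "pot [?V] + 27 = 40 * card R" by (simp add: pot_def posV)
  moreover have "holds e (IsNull r_node) s = False" using node by simp
  ultimately show ?thesis
    unfolding report_subtree_def block.simps run_If run_Seq run_Do run_Skip if_False
    by (simp only: if_False run_Seq run_Do run_Skip) (rule run_mono[OF loop], auto)
qed

lemma run_search:
  assumes "search_inv e 0 s"
  defines "m \<equiv> length (pattern e)"
  shows "run e (While (Less r_i r_len) read_symbol) s
    (\<lambda>t s'. search_inv e m s' \<and> t \<le> m * (26 + 6 * search_cost e) + 1)"
proof -
  \<comment> \<open>The bound for \<open>read_symbol\<close> plus 1 for the loop test.\<close>
  let ?k = "26 + 6 * search_cost e"
  define I where "I n s' \<longleftrightarrow> (\<exists>j. search_inv e j s' \<and> n = (m - j) * ?k)" for n s'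
  have "I (m * ?k) s" using assms(1) unfolding I_def by (intro exI[of _ 0]) simp
  then have "run e (While (Less r_i r_len) read_symbol) s
      (\<lambda>t s'. \<exists>n'. I n' s' \<and> \<not> holds e (Less r_i r_len) s' \<and> t + n' \<le> m * ?k + 1)"
  proof (rule run_While)
    fix n s' assume "I n s'" and b: "holds e (Less r_i r_len) s'"
    then obtain j where j: "search_inv e j s'" "n = (m - j) * ?k" unfolding I_def by blast
    then have jm: "j < length (pattern e)" using b by (simp add: search_inv_def)
    then have n: "n = (m - Suc j) * ?k + ?k"
      unfolding j(2) m_def by (metis Suc_diff_Suc add.commute mult_Suc)
    show "run e read_symbol s' (\<lambda>t s''. \<exists>n'. I n' s'' \<and> t + 1 + n' \<le> n)"
      by (rule run_mono[OF run_read_symbol[OF j(1) jm]]) (use n in \<open>auto simp: I_def\<close>)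
  qed
  then show ?thesis
  proof (rule run_mono)
    fix t s' assume "\<exists>n'. I n' s' \<and> \<not> holds e (Less r_i r_len) s' \<and> t + n' \<le> m * ?k + 1"
    then obtain j n' where j: "search_inv e j s'" "\<not> holds e (Less r_i r_len) s'" "t + n' \<le> m * ?k + 1"
      unfolding I_def by blast
    then have "j = m" by (auto simp: search_inv_def m_def)
    then show "search_inv e m s' \<and> t \<le> m * ?k + 1" using j by simp
  qed
qed

section \<open>Total running time\<close>

lemma run_find_all:
  fixes \<Sigma> :: "'a set" and d :: nat
  assumes "finite \<Sigma>" "finite \<Pi>" "T \<in> lists (\<Sigma> \<union> \<Pi>)" "P \<in> lists (\<Sigma> \<union> \<Pi>)"
    "lists_inlinks (prev \<Sigma> T) links"
  defines "e \<equiv> \<lparr>statics = \<Sigma>, encoded = prev \<Sigma> T, inlinks = links, pattern = P, search_cost = d\<rparr>"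
  shows "run e find_all init (\<lambda>t s. distinct (out s) \<and> set (out s) = occs \<Sigma> \<Pi> T P \<and>
    t \<le> 20 + length P * (26 + 6 * d) + 40 * card (occs \<Sigma> \<Pi> T P))"
proof -
  let ?w = "prev \<Sigma> T" and ?R = "RPos (prev \<Sigma> T) (prev \<Sigma> P)" and ?m = "length P"
  let ?O = "occs \<Sigma> \<Pi> T P"
  have O: "?O = (\<lambda>i. i - ?m) ` ?R" by (rule occs_eq_RPos[OF assms(1-4)])
  \<comment> \<open>End positions are at least \<open>?m\<close>, so the truncated subtraction is
    injective on them.\<close>
  have inj: "inj_on (\<lambda>i. i - ?m) ?R" by (rule inj_onI) (auto simp: RPos_iff)
  have card: "card ?O = card ?R" unfolding O by (rule card_image[OF inj])
  let ?s = "step e (Source r_node) (step e (Const r_i 0) (step e (PatLen r_len)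
    (step e (Const r_one 1) (step e (Const r_zero 0) init))))"
  have "locus ?w [] = Node (source ?w)" by (simp add: locus_def source_def RPos_Nil)
  then have inv: "search_inv e 0 ?s"
    by (simp add: search_inv_def e_def init_def last_seen_def prev_def)
  have "run e (While (Less r_i r_len) read_symbol) ?s (\<lambda>t s. run e report_subtree s (\<lambda>u s'.
      distinct (out s') \<and> set (out s') = ?O \<and> t + u \<le> ?m * (26 + 6 * d) + 11 + 40 * card ?O))"
  proof (rule run_mono[OF run_search[OF inv]])
    fix t s
    assume s: "search_inv e (length (pattern e)) s \<and> t \<le> length (pattern e) * (26 + 6 * search_cost e) + 1"
    have "run e report_subtree s (\<lambda>u s'. u \<le> 10 + 40 * card (RPos (encoded e) (prev \<Sigma> P)) \<and> distinct (out s') \<and>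
        set (out s') = (\<lambda>i. i - ?m) ` RPos (encoded e) (prev \<Sigma> P))"
      by (rule run_report_subtree) (use s assms(5) inj in \<open>simp_all add: search_inv_def e_def reenc_prev\<close>)
    then show "run e report_subtree s (\<lambda>u s'.
        distinct (out s') \<and> set (out s') = ?O \<and> t + u \<le> ?m * (26 + 6 * d) + 11 + 40 * card ?O)"
      by (rule run_mono) (use s card O in \<open>auto simp: e_def\<close>)
  qed
  then show ?thesis
    unfolding find_all_def block.simps run_Seq run_Do run_Skip
    by (rule run_mono) (erule run_mono, auto)
qed

theorem theorem2:
  shows "\<exists>prog :: com. \<forall>K :: real. \<exists>C :: real.
    \<forall>(\<Sigma> :: 'a set) \<Pi> T P links d.
      finite \<Sigma> \<and> finite \<Pi> \<and> \<Sigma> \<inter> \<Pi> = {} \<and>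
      T \<in> lists (\<Sigma> \<union> \<Pi>) \<and> P \<in> lists (\<Sigma> \<union> \<Pi>) \<and>
      lists_inlinks (prev \<Sigma> T) links \<and>
      real d \<le> K * log_size \<Sigma> \<Pi> \<longrightarrow>
      (\<exists>t s. exec \<lparr>statics = \<Sigma>, encoded = prev \<Sigma> T, inlinks = links,
                   pattern = P, search_cost = d\<rparr> prog init t s \<and>
             distinct (out s) \<and> set (out s) = occs \<Sigma> \<Pi> T P \<and>
             real t \<le> C * (real (length P) * log_size \<Sigma> \<Pi> + real (card (occs \<Sigma> \<Pi> T P))))"
proof (intro exI[of _ find_all] allI, rule_tac x = "60 + 6 * \<bar>K\<bar>" in exI, intro allI impI, elim conjE)
  fix K :: real and \<Sigma> \<Pi> :: "'a set" and T P links d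
  assume asm: "finite \<Sigma>" "finite \<Pi>" "T \<in> lists (\<Sigma> \<union> \<Pi>)" "P \<in> lists (\<Sigma> \<union> \<Pi>)"
    "lists_inlinks (prev \<Sigma> T) links" and d: "real d \<le> K * log_size \<Sigma> \<Pi>"
  let ?O = "occs \<Sigma> \<Pi> T P" and ?m = "real (length P)" and ?log = "log_size \<Sigma> \<Pi>"
  \<comment> \<open>Here 60 covers 40 per occurrence, or 26 per unit of \<open>?m * ?log\<close>,
    together with the fixed cost 20. The absolute value allows for a negative
    \<open>K\<close>.\<close>
  let ?C = "60 + 6 * \<bar>K\<bar>"
  have log: "1 \<le> ?log" by (simp add: log_size_def)
  have "K * ?log \<le> \<bar>K\<bar> * ?log" using log by (intro mult_right_mono) auto
  with d have d': "real d \<le> \<bar>K\<bar> * ?log" by linarith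
  have "?m * (26 + 6 * real d) \<le> ?m * ((26 + 6 * \<bar>K\<bar>) * ?log)"
    using d' log by (intro mult_left_mono) (auto simp: algebra_simps)
  also have "\<dots> = 26 * (?m * ?log) + 6 * (\<bar>K\<bar> * (?m * ?log))" by (simp add: algebra_simps)
  finally have search: "?m * (26 + 6 * real d) \<le> 26 * (?m * ?log) + 6 * (\<bar>K\<bar> * (?m * ?log))" .
  have nonneg: "0 \<le> \<bar>K\<bar> * real (card ?O)" by simp
  \<comment> \<open>Only a bracket of at least 1 can absorb the fixed cost. For the empty pattern
    this rests on the occurrence at 0, otherwise on \<open>log\<close>.\<close>
  have "1 \<le> ?m * ?log + real (card ?O)"
  proof (cases "P = []")
    case True
    have "finite ?O" unfolding occs_eq_RPos[OF asm(1-4)] by simp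
    moreover have "0 \<in> ?O"
      unfolding occs_eq_RPos[OF asm(1-4)] using True by (simp add: prev_def RPos_Nil)
    ultimately have "1 \<le> card ?O" by (metis One_nat_def Suc_leI card_gt_0_iff empty_iff)
    then show ?thesis using True by simp
  next
    case False
    then have "1 \<le> ?m" by (cases P) auto
    then have "1 * 1 \<le> ?m * ?log" using log by (intro mult_mono) auto
    then show ?thesis by simp
  qed
  moreover have "0 \<le> ?m * ?log" using log by simp
  moreover have "?C * (?m * ?log + real (card ?O)) = 60 * (?m * ?log) + 60 * real (card ?O)
      + 6 * (\<bar>K\<bar> * (?m * ?log)) + 6 * (\<bar>K\<bar> * real (card ?O))"
    by (simp add: algebra_simps)
  ultimately have "20 + ?m * (26 + 6 * real d) + 40 * real (card ?O) \<le> ?C * (?m * ?log + real (card ?O))"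
    using search nonneg by linarith
  moreover obtain t s where ts: "exec \<lparr>statics = \<Sigma>, encoded = prev \<Sigma> T, inlinks = links, pattern = P, search_cost = d\<rparr>
      find_all init t s" "distinct (out s)" "set (out s) = ?O"
    "t \<le> 20 + length P * (26 + 6 * d) + 40 * card ?O"
    using run_find_all[OF asm, of d] unfolding run_def by blast
  moreover have "real t \<le> 20 + ?m * (26 + 6 * real d) + 40 * real (card ?O)"
    using of_nat_mono[OF ts(4), where 'a = real] by simp
  ultimately show "\<exists>t s. exec \<lparr>statics = \<Sigma>, encoded = prev \<Sigma> T, inlinks = links,
        pattern = P, search_cost = d\<rparr> find_all init t s \<and> distinct (out s) \<and> set (out s) = ?O \<and>
      real t \<le> ?C * (?m * ?log + real (card ?O))"
    by (intro exI conjI) (rule ts, rule ts, rule ts, linarith)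
qed

end
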